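(* Let $k$ be a field, $V\subseteq k^n$ an affine algebraic subvariety with sheaf of regular functions $\mathcal O_V$, and $h\in k[V]$. The natural $k$-algebra morphism $$k[V]_{\langle h\rangle}\to \Gamma(D_V(h),\mathcal O_V),\qquad g/\alpha\mapsto [P\mapsto g(P)/\alpha(P)]$$ is an isomorphism. In particular, $\mathcal O_V$ is a sheaf of essential $*$-algebras over $V$.
   Context: $k$ is an arbitrary field; rings are commutative and unital. $V\subseteq k^n$ is the zero set in $k^n$ of an ideal of $k[X_1,\ldots,X_n]$, with the Zariski topology; $k[V]=k[X_1,\ldots,X_n]/\mathcal I(V)$ with $\mathcal I(V)=\{f:\forall P\in V, f(P)=0\}$. For $h\in k[V]$, $D_V(h)=\{P\in V: h(P)\neq 0\}$. For $U\subseteq V$ open, $\mathcal O_V(U)$ is the $k$-algebra of functions $f:U\to k$ such that every $P\in U$ has an open neighbourhood $U_P\subseteq U$ and $g,l\in k[V]$ with $l(Q)\neq0$ and $f(Q)=g(Q)/l(Q)$ for all $Q\in U_P$. The algebraic signature $\mathcal D$ of $k$ is the set of all polynomials in finitely many variables over $k$ with no zero rational in $k$ (nonzero constants included). For $D=\sum_{\bar i}a_{\bar i}\bar X^{\bar i}\in\mathcal D$ of total degree $d$, $D^\#(\bar X,Y)=\sum_{\bar i}a_{\bar i}\bar X^{\bar i}Y^{d-|\bar i|}$. For a $k$-algebra $A$ and $a\in A$, $\Sigma_a$ is the multiplicative subset of $A$ generated by all elements $a^mD^\#(\bar b,a^n)$ with $D\in\mathcal D$, $m,n\in\mathbb N$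 and $\bar b$ an appropriate tuple from $A$; and $A_{\langle a\rangle}:=\Sigma_a^{-1}A$. Elements $\alpha\in\Sigma_h$ do not vanish on $D_V(h)$. A $k$-algebra $A$ is a $*$-algebra if $D(\bar a)$ is invertible in $A$ for all $D\in\mathcal D$ and all appropriate tuples $\bar a$ from $A$. A $k$-algebra is essential if it embeds as a $k$-algebra into a power $k^S$ of $k$ ($S$ a set, possibly empty). *)

theory Defs
  imports
    "HOL-Algebra.QuotRing"
    "HOL-Algebra.Module"
    "HOL-Algebra.Algebraic_Closure_Type"
    "HOL-Analysis.Abstract_Topology"
    "HOL-Library.Poly_Mapping"
begin

text \<open>
  The base field is a type \<open>'k\<close> of class \<^class>\<open>field\<close>; viewed as a ring record it is
  \<^const>\<open>ring_of_type_algebra\<close>.  A polynomial over \<open>'k\<close> in variables \<open>'v\<close> is a finitely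
  supported map from monomials (finitely supported exponent functions) to coefficients, so it
  always involves only finitely many variables.
\<close>

type_synonym ('v, 'k) mpoly = "('v \<Rightarrow>\<^sub>0 nat) \<Rightarrow>\<^sub>0 'k"

definition Const :: "'k::field \<Rightarrow> ('v, 'k) mpoly" where
  "Const c = Poly_Mapping.single 0 c"

definition Var :: "'v \<Rightarrow> ('v, 'k::field) mpoly" where
  "Var v = Poly_Mapping.single (Poly_Mapping.single v 1) 1"

definition mon_deg :: "('v \<Rightarrow>\<^sub>0 nat) \<Rightarrow> nat" where
  "mon_deg m = (\<Sum>v\<in>Poly_Mapping.keys m. Poly_Mapping.lookup m v)"

definition total_deg :: "('v, 'k::field) mpoly \<Rightarrow> nat" where
  "total_deg p = Max (insert 0 (mon_deg ` Poly_Mapping.keys p))"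

definition mpoly_eval :: "('v \<Rightarrow> 'k) \<Rightarrow> ('v, 'k::field) mpoly \<Rightarrow> 'k" where
  "mpoly_eval P p = (\<Sum>m\<in>Poly_Mapping.keys p. Poly_Mapping.lookup p m *
      (\<Prod>v\<in>Poly_Mapping.keys m. P v ^ Poly_Mapping.lookup m v))"

definition kalgebra :: "('k::field, 'a, 'm) module_scheme \<Rightarrow> bool" where
  "kalgebra A \<longleftrightarrow> algebra (ring_of_type_algebra :: 'k ring) A"

definition kalg_hom ::
  "('k::field, 'a, 'm) module_scheme \<Rightarrow> ('k, 'b, 'n) module_scheme \<Rightarrow> ('a \<Rightarrow> 'b) \<Rightarrow> bool" where
  "kalg_hom A B \<phi> \<longleftrightarrow> kalgebra A \<and> kalgebra B \<and> \<phi> \<in> ring_hom A B \<and>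
     (\<forall>c. \<forall>x\<in>carrier A. \<phi> (c \<odot>\<^bsub>A\<^esub> x) = c \<odot>\<^bsub>B\<^esub> \<phi> x)"

definition kalg_iso ::
  "('k::field, 'a, 'm) module_scheme \<Rightarrow> ('k, 'b, 'n) module_scheme \<Rightarrow> ('a \<Rightarrow> 'b) \<Rightarrow> bool" where
  "kalg_iso A B \<phi> \<longleftrightarrow> kalg_hom A B \<phi> \<and> bij_betw \<phi> (carrier A) (carrier B)"

text \<open>A tuple from \<open>A\<close> is given by an assignment \<open>b\<close> of elements of \<open>A\<close> to all variables; only the
  variables occurring in \<open>p\<close> matter.\<close>

definition alg_eval ::
  "('k::field, 'a, 'm) module_scheme \<Rightarrow> ('v \<Rightarrow> 'a) \<Rightarrow> ('v, 'k) mpoly \<Rightarrow> 'a" where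
  "alg_eval A b p = (\<Oplus>\<^bsub>A\<^esub>m\<in>Poly_Mapping.keys p. Poly_Mapping.lookup p m \<odot>\<^bsub>A\<^esub>
      (\<Otimes>\<^bsub>A\<^esub>v\<in>Poly_Mapping.keys m. b v [^]\<^bsub>A\<^esub> Poly_Mapping.lookup m v))"

text \<open>Multiplication by \<open>c\<close> maps the coset \<open>I + x\<close> to \<open>I + c x\<close>.\<close>

definition quot_algebra ::
  "('k, 'a, 'm) module_scheme \<Rightarrow> 'a set \<Rightarrow> ('k, 'a set) module" where
  "quot_algebra A I = ring.extend (A Quot I)
     (module.fields (\<lambda>c C. \<Union>x\<in>C. I +>\<^bsub>A\<^esub> (c \<odot>\<^bsub>A\<^esub> x)))"

definition power_algebra :: "'s set \<Rightarrow> ('k::field, 's \<Rightarrow> 'k) module" where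
  "power_algebra S = \<lparr>carrier = S \<rightarrow>\<^sub>E UNIV,
     monoid.mult = (\<lambda>f g. \<lambda>s\<in>S. f s * g s), one = (\<lambda>s\<in>S. 1),
     ring.zero = (\<lambda>s\<in>S. 0), add = (\<lambda>f g. \<lambda>s\<in>S. f s + g s),
     module.smult = (\<lambda>c f. \<lambda>s\<in>S. c * f s)\<rparr>"

definition loc_rel :: "('k, 'a, 'm) module_scheme \<Rightarrow> 'a set \<Rightarrow> (('a \<times> 'a) \<times> ('a \<times> 'a)) set" where
  "loc_rel A S = {((a, s), (b, t)). a \<in> carrier A \<and> b \<in> carrier A \<and> s \<in> S \<and> t \<in> S \<and>
     (\<exists>u\<in>S. u \<otimes>\<^bsub>A\<^esub> (a \<otimes>\<^bsub>A\<^esub> t \<ominus>\<^bsub>A\<^esub> b \<otimes>\<^bsub>A\<^esub> s) = \<zero>\<^bsub>A\<^esub>)}"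

definition loc_frac :: "('k, 'a, 'm) module_scheme \<Rightarrow> 'a set \<Rightarrow> 'a \<Rightarrow> 'a \<Rightarrow> ('a \<times> 'a) set" where
  "loc_frac A S a s = loc_rel A S `` {(a, s)}"

definition localization ::
  "('k, 'a, 'm) module_scheme \<Rightarrow> 'a set \<Rightarrow> ('k, ('a \<times> 'a) set) module" where
  "localization A S = \<lparr>carrier = (carrier A \<times> S) // loc_rel A S,
     monoid.mult = (\<lambda>C D. \<Union>(a, s)\<in>C. \<Union>(b, t)\<in>D. loc_frac A S (a \<otimes>\<^bsub>A\<^esub> b) (s \<otimes>\<^bsub>A\<^esub> t)),
     one = loc_frac A S \<one>\<^bsub>A\<^esub> \<one>\<^bsub>A\<^esub>,
     ring.zero = loc_frac A S \<zero>\<^bsub>A\<^esub> \<one>\<^bsub>A\<^esub>,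
     add = (\<lambda>C D. \<Union>(a, s)\<in>C. \<Union>(b, t)\<in>D.
       loc_frac A S (a \<otimes>\<^bsub>A\<^esub> t \<oplus>\<^bsub>A\<^esub> b \<otimes>\<^bsub>A\<^esub> s) (s \<otimes>\<^bsub>A\<^esub> t)),
     module.smult = (\<lambda>c C. \<Union>(a, s)\<in>C. loc_frac A S (c \<odot>\<^bsub>A\<^esub> a) s)\<rparr>"

text \<open>The zero polynomial is excluded because it vanishes everywhere; nonzero constants belong to
  the signature.\<close>

definition alg_signature :: "(nat, 'k::field) mpoly set" where
  "alg_signature = {D. \<forall>P. mpoly_eval P D \<noteq> 0}"

text \<open>Homogenization: the additional variable \<open>Y\<close> is \<open>None\<close>, the old variables are \<open>Some v\<close>.\<close>

definition homogenize :: "('v, 'k::field) mpoly \<Rightarrow> ('v option, 'k) mpoly" where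
  "homogenize D = (\<Sum>m\<in>Poly_Mapping.keys D. Const (Poly_Mapping.lookup D m) *
      (\<Prod>v\<in>Poly_Mapping.keys m. Var (Some v) ^ Poly_Mapping.lookup m v) *
      Var None ^ (total_deg D - mon_deg m))"

inductive_set Sigma_set :: "('k::field, 'a, 'm) module_scheme \<Rightarrow> 'a \<Rightarrow> 'a set"
  for A :: "('k, 'a, 'm) module_scheme" and a :: 'a where
  one: "\<one>\<^bsub>A\<^esub> \<in> Sigma_set A a"
| gen: "D \<in> alg_signature \<Longrightarrow> b \<in> UNIV \<rightarrow> carrier A \<Longrightarrow>
    a [^]\<^bsub>A\<^esub> (m::nat) \<otimes>\<^bsub>A\<^esub>
      alg_eval A (case_option (a [^]\<^bsub>A\<^esub> (n::nat)) b) (homogenize D) \<in> Sigma_set A a"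
| mult: "x \<in> Sigma_set A a \<Longrightarrow> y \<in> Sigma_set A a \<Longrightarrow> x \<otimes>\<^bsub>A\<^esub> y \<in> Sigma_set A a"

definition Sigma_localization ::
  "('k::field, 'a, 'm) module_scheme \<Rightarrow> 'a \<Rightarrow> ('k, ('a \<times> 'a) set) module" where
  "Sigma_localization A a = localization A (Sigma_set A a)"

definition star_algebra :: "('k::field, 'a, 'm) module_scheme \<Rightarrow> bool" where
  "star_algebra A \<longleftrightarrow> kalgebra A \<and>
     (\<forall>D\<in>alg_signature. \<forall>b\<in>UNIV \<rightarrow> carrier A. alg_eval A b D \<in> Units A)"

text \<open>HOL cannot quantify over the type of the index set \<open>S\<close>.  The components of an embedding into
  a power are functions from \<open>A\<close> to the field, so nothing is lost by taking \<open>S\<close> to be a set of such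
  functions; see \<open>essentialI\<close> below.\<close>

definition essential :: "('k::field, 'a, 'm) module_scheme \<Rightarrow> bool" where
  "essential A \<longleftrightarrow> (\<exists>(S :: ('a \<Rightarrow> 'k) set) \<phi>. kalg_hom A (power_algebra S) \<phi> \<and> inj_on \<phi> (carrier A))"

lemma kalgebra_power: "kalgebra (power_algebra S :: ('k::field, 's \<Rightarrow> 'k) module)"
proof -
  have group: "\<exists>g\<in>S \<rightarrow>\<^sub>E UNIV. \<forall>s. s \<in> S \<longrightarrow> f s + g s = 0" for f :: "'s \<Rightarrow> 'k"
    by (rule bexI[of _ "\<lambda>s\<in>S. - f s"]) auto
  have "cring (power_algebra S :: ('k, 's \<Rightarrow> 'k) module)"
    by (rule cringI; (rule abelian_groupI comm_monoidI)?)
       (use group in \<open>auto simp: power_algebra_def fun_eq_iff algebra_simps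
          restrict_def PiE_iff extensional_def\<close>)
  then show ?thesis
    unfolding kalgebra_def
    by (intro algebraI cring_from_type_algebra)
       (auto simp: power_algebra_def ring_of_type_algebra_def fun_eq_iff algebra_simps
          restrict_def PiE_iff extensional_def)
qed

lemma essentialI:
  fixes A :: "('k::field, 'a, 'm) module_scheme" and S :: "'s set"
  assumes hom: "kalg_hom A (power_algebra S) \<phi>" and inj: "inj_on \<phi> (carrier A)"
  shows "essential A"
proof -
  define T where "T = (\<lambda>s a. \<phi> a s) ` S"
  define \<psi> where "\<psi> = (\<lambda>a. \<lambda>f\<in>T. f a)"
  have "kalg_hom A (power_algebra T) \<psi>"
    using hom kalgebra_power[of T]
    unfolding kalg_hom_def ring_hom_def
    by (auto simp: power_algebra_def \<psi>_def fun_eq_iff T_def restrict_def)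
  moreover have "inj_on \<psi> (carrier A)"
  proof (rule inj_onI)
    fix a b assume ab: "a \<in> carrier A" "b \<in> carrier A" "\<psi> a = \<psi> b"
    have "\<phi> a s = \<phi> b s" if "s \<in> S" for s
      using fun_cong[OF ab(3), of "\<lambda>a. \<phi> a s"] that by (auto simp: \<psi>_def T_def)
    moreover have "\<phi> a \<in> S \<rightarrow>\<^sub>E UNIV" "\<phi> b \<in> S \<rightarrow>\<^sub>E UNIV"
      using hom ab unfolding kalg_hom_def ring_hom_def by (auto simp: power_algebra_def)
    ultimately have "\<phi> a = \<phi> b" by (intro PiE_ext) auto
    then show "a = b" using inj ab by (auto dest: inj_onD)
  qed
  ultimately show ?thesis unfolding essential_def by blast
qed

text \<open>Points of $k^n$ are functions on \<open>{..<n}\<close> extended by \<^const>\<open>undefined\<close>.\<close>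

definition affine_space :: "nat \<Rightarrow> (nat \<Rightarrow> 'k::field) set" where
  "affine_space n = {..<n} \<rightarrow>\<^sub>E UNIV"

definition poly_algebra :: "nat \<Rightarrow> ('k::field, (nat, 'k) mpoly) module" where
  "poly_algebra n = \<lparr>carrier = {p. \<forall>m\<in>Poly_Mapping.keys p. Poly_Mapping.keys m \<subseteq> {..<n}},
     monoid.mult = (*), one = 1, ring.zero = 0, add = (+), module.smult = (\<lambda>c p. Const c * p)\<rparr>"

definition zero_set :: "nat \<Rightarrow> (nat, 'k::field) mpoly set \<Rightarrow> (nat \<Rightarrow> 'k) set" where
  "zero_set n F = {P \<in> affine_space n. \<forall>p\<in>F. mpoly_eval P p = 0}"

definition affine_variety :: "nat \<Rightarrow> (nat \<Rightarrow> 'k::field) set \<Rightarrow> bool" where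
  "affine_variety n V \<longleftrightarrow> (\<exists>I. ideal I (poly_algebra n) \<and> V = zero_set n I)"

definition zariski_topology :: "nat \<Rightarrow> (nat \<Rightarrow> 'k::field) topology" where
  "zariski_topology n =
     topology (\<lambda>U. \<exists>F\<subseteq>carrier (poly_algebra n). U = affine_space n - zero_set n F)"

lemma mpoly_eval_superset:
  assumes "finite K" "Poly_Mapping.keys p \<subseteq> K"
  shows "mpoly_eval P p = (\<Sum>m\<in>K. Poly_Mapping.lookup p m *
      (\<Prod>v\<in>Poly_Mapping.keys m. P v ^ Poly_Mapping.lookup m v))"
  unfolding mpoly_eval_def using assms
  by (intro sum.mono_neutral_left) (auto simp: in_keys_iff)

lemma mpoly_eval_add: "mpoly_eval P (p + q) = mpoly_eval P p + mpoly_eval P q"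
proof -
  let ?K = "Poly_Mapping.keys p \<union> Poly_Mapping.keys q"
  have "Poly_Mapping.keys (p + q) \<subseteq> ?K" by (rule keys_add)
  then show ?thesis
    by (simp add: mpoly_eval_superset[of ?K] lookup_add distrib_right sum.distrib)
qed

lemma mpoly_eval_sum: "mpoly_eval P (sum f C) = (\<Sum>x\<in>C. mpoly_eval P (f x))"
  by (induction C rule: infinite_finite_induct)
     (simp_all add: mpoly_eval_add, simp_all add: mpoly_eval_def)

lemma mon_eval_add:
  fixes P :: "'v \<Rightarrow> 'k::field"
  shows "(\<Prod>v\<in>Poly_Mapping.keys (m + m'). P v ^ Poly_Mapping.lookup (m + m') v) =
    (\<Prod>v\<in>Poly_Mapping.keys m. P v ^ Poly_Mapping.lookup m v) *
    (\<Prod>v\<in>Poly_Mapping.keys m'. P v ^ Poly_Mapping.lookup m' v)"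
proof -
  let ?K = "Poly_Mapping.keys m \<union> Poly_Mapping.keys m'"
  have ext: "(\<Prod>v\<in>Poly_Mapping.keys l. P v ^ Poly_Mapping.lookup l v) =
      (\<Prod>v\<in>?K. P v ^ Poly_Mapping.lookup l v)" if "Poly_Mapping.keys l \<subseteq> ?K" for l
    using that by (intro prod.mono_neutral_left) (auto simp: in_keys_iff)
  show ?thesis
    by (subst ext[OF keys_add], subst ext[of m], simp, subst ext[of m'], simp)
       (simp add: lookup_add power_add prod.distrib)
qed

lemma mpoly_eval_single:
  "mpoly_eval P (Poly_Mapping.single m c) =
    c * (\<Prod>v\<in>Poly_Mapping.keys m. P v ^ Poly_Mapping.lookup m v)"
  by (simp add: mpoly_eval_def)

lemma mpoly_eval_mult: "mpoly_eval P (p * q) = mpoly_eval P p * mpoly_eval P q"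
proof -
  have expand: "r = (\<Sum>m\<in>Poly_Mapping.keys r.
      Poly_Mapping.single m (Poly_Mapping.lookup r m))" for r :: "('v, 'k::field) mpoly"
    by (rule poly_mapping_eqI)
       (auto simp: lookup_sum lookup_single when_def in_keys_iff)
  have "p * q = (\<Sum>m\<in>Poly_Mapping.keys p. \<Sum>m'\<in>Poly_Mapping.keys q.
      Poly_Mapping.single (m + m') (Poly_Mapping.lookup p m * Poly_Mapping.lookup q m'))"
    by (subst expand[of p], subst expand[of q]) (simp add: sum_product mult_single)
  then show ?thesis
    by (simp add: mpoly_eval_sum mpoly_eval_single mon_eval_add)
       (simp add: mpoly_eval_def sum_product mult_ac)
qed

lemma istopology_zariski:
  "istopology (\<lambda>U :: (nat \<Rightarrow> 'k::field) set.
     \<exists>F\<subseteq>carrier (poly_algebra n). U = affine_space n - zero_set n F)"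
  unfolding istopology_def
proof (intro conjI allI impI)
  fix U W :: "(nat \<Rightarrow> 'k) set"
  assume "\<exists>F\<subseteq>carrier (poly_algebra n). U = affine_space n - zero_set n F"
    and "\<exists>F\<subseteq>carrier (poly_algebra n). W = affine_space n - zero_set n F"
  then obtain F G where F: "F \<subseteq> carrier (poly_algebra n)" "U = affine_space n - zero_set n F"
    and G: "G \<subseteq> carrier (poly_algebra n)" "W = affine_space n - zero_set n G"
    by blast
  let ?H = "{p * q | p q. p \<in> F \<and> q \<in> G}"
  have "?H \<subseteq> carrier (poly_algebra n)"
  proof
    fix r assume "r \<in> ?H"
    then obtain p q where r: "r = p * q" "p \<in> F" "q \<in> G" by blast
    show "r \<in> carrier (poly_algebra n)"
      unfolding poly_algebra_def
    proof (simp, intro ballI)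
      fix m assume "m \<in> Poly_Mapping.keys r"
      then obtain a b where "a \<in> Poly_Mapping.keys p" "b \<in> Poly_Mapping.keys q" "m = a + b"
        using keys_mult[of p q] r by blast
      then show "Poly_Mapping.keys m \<subseteq> {..<n}"
        using F(1) G(1) r keys_add[of a b] unfolding poly_algebra_def by fastforce
    qed
  qed
  moreover have "U \<inter> W = affine_space n - zero_set n ?H"
  proof (intro equalityI subsetI)
    fix P assume "P \<in> U \<inter> W"
    then show "P \<in> affine_space n - zero_set n ?H"
      unfolding F(2) G(2) zero_set_def by simp (metis mpoly_eval_mult mult_eq_0_iff)
  next
    fix P assume "P \<in> affine_space n - zero_set n ?H"
    then show "P \<in> U \<inter> W"
      unfolding F(2) G(2) zero_set_def by (auto simp: mpoly_eval_mult)
  qed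
  ultimately show "\<exists>F\<subseteq>carrier (poly_algebra n). U \<inter> W = affine_space n - zero_set n F"
    by blast
next
  fix \<K> :: "(nat \<Rightarrow> 'k) set set"
  assume "\<forall>K\<in>\<K>. \<exists>F\<subseteq>carrier (poly_algebra n). K = affine_space n - zero_set n F"
  then obtain F where F: "\<forall>K\<in>\<K>. F K \<subseteq> carrier (poly_algebra n) \<and>
      K = affine_space n - zero_set n (F K)"
    by metis
  have "\<Union>\<K> = affine_space n - zero_set n (\<Union>K\<in>\<K>. F K)"
  proof -
    have "\<Union>\<K> = (\<Union>K\<in>\<K>. affine_space n - zero_set n (F K))"
      using F by auto
    then show ?thesis by (auto simp: zero_set_def)
  qed
  then show "\<exists>F\<subseteq>carrier (poly_algebra n). \<Union>\<K> = affine_space n - zero_set n F"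
    using F by (intro exI[of _ "\<Union>K\<in>\<K>. F K"]) auto
qed

lemma openin_zariski:
  "openin (zariski_topology n) U \<longleftrightarrow>
     (\<exists>F\<subseteq>carrier (poly_algebra n). U = affine_space n - zero_set n F)"
  unfolding zariski_topology_def by (simp add: topology_inverse'[OF istopology_zariski])

definition vanishing_ideal :: "nat \<Rightarrow> (nat \<Rightarrow> 'k::field) set \<Rightarrow> (nat, 'k) mpoly set" where
  "vanishing_ideal n V = {f \<in> carrier (poly_algebra n). \<forall>P\<in>V. mpoly_eval P f = 0}"

definition coord_algebra ::
  "nat \<Rightarrow> (nat \<Rightarrow> 'k::field) set \<Rightarrow> ('k, (nat, 'k) mpoly set) module" where
  "coord_algebra n V = quot_algebra (poly_algebra n) (vanishing_ideal n V)"

text \<open>The value at \<open>P \<in> V\<close> of an element of the coordinate algebra, i.e. the common value at \<open>P\<close> of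
  all polynomials in the coset.\<close>

definition coord_eval :: "(nat \<Rightarrow> 'k::field) \<Rightarrow> (nat, 'k) mpoly set \<Rightarrow> 'k" where
  "coord_eval P g = the_elem (mpoly_eval P ` g)"

definition basic_open :: "(nat \<Rightarrow> 'k::field) set \<Rightarrow> (nat, 'k) mpoly set \<Rightarrow> (nat \<Rightarrow> 'k) set" where
  "basic_open V h = {P \<in> V. coord_eval P h \<noteq> 0}"

definition variety_topology :: "nat \<Rightarrow> (nat \<Rightarrow> 'k::field) set \<Rightarrow> (nat \<Rightarrow> 'k) topology" where
  "variety_topology n V = subtopology (zariski_topology n) V"

definition regular_functions ::
  "nat \<Rightarrow> (nat \<Rightarrow> 'k::field) set \<Rightarrow> (nat \<Rightarrow> 'k) set \<Rightarrow> ((nat \<Rightarrow> 'k) \<Rightarrow> 'k) set" where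
  "regular_functions n V U = {f \<in> U \<rightarrow>\<^sub>E UNIV. \<forall>P\<in>U. \<exists>W.
     openin (variety_topology n V) W \<and> P \<in> W \<and> W \<subseteq> U \<and>
     (\<exists>g\<in>carrier (coord_algebra n V). \<exists>l\<in>carrier (coord_algebra n V).
        \<forall>Q\<in>W. coord_eval Q l \<noteq> 0 \<and> f Q = coord_eval Q g / coord_eval Q l)}"

definition regular_algebra ::
  "nat \<Rightarrow> (nat \<Rightarrow> 'k::field) set \<Rightarrow> (nat \<Rightarrow> 'k) set \<Rightarrow> ('k, (nat \<Rightarrow> 'k) \<Rightarrow> 'k) module" where
  "regular_algebra n V U = (power_algebra U)\<lparr>carrier := regular_functions n V U\<rparr>"

text \<open>\<open>res U W\<close> is the restriction morphism from \<open>F U\<close> to \<open>F W\<close> for \<open>W \<subseteq> U\<close>.  The cover may be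
  empty, so sections over the empty set form a zero algebra.\<close>

definition kalg_sheaf ::
  "'p topology \<Rightarrow> ('p set \<Rightarrow> ('k::field, 'a) module) \<Rightarrow>
   ('p set \<Rightarrow> 'p set \<Rightarrow> 'a \<Rightarrow> 'a) \<Rightarrow> bool" where
  "kalg_sheaf T F res \<longleftrightarrow>
     (\<forall>U W. openin T U \<and> openin T W \<and> W \<subseteq> U \<longrightarrow> kalg_hom (F U) (F W) (res U W)) \<and>
     (\<forall>U. openin T U \<longrightarrow> (\<forall>f\<in>carrier (F U). res U U f = f)) \<and>
     (\<forall>U W Z. openin T U \<and> openin T W \<and> openin T Z \<and> Z \<subseteq> W \<and> W \<subseteq> U \<longrightarrow>
        (\<forall>f\<in>carrier (F U). res W Z (res U W f) = res U Z f)) \<and>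
     (\<forall>\<U>. (\<forall>W\<in>\<U>. openin T W) \<longrightarrow>
        (\<forall>f\<in>carrier (F (\<Union>\<U>)). \<forall>g\<in>carrier (F (\<Union>\<U>)).
           (\<forall>W\<in>\<U>. res (\<Union>\<U>) W f = res (\<Union>\<U>) W g) \<longrightarrow> f = g)) \<and>
     (\<forall>\<U> s. (\<forall>W\<in>\<U>. openin T W \<and> s W \<in> carrier (F W)) \<and>
        (\<forall>W\<in>\<U>. \<forall>Z\<in>\<U>. res W (W \<inter> Z) (s W) = res Z (W \<inter> Z) (s Z)) \<longrightarrow>
        (\<exists>f\<in>carrier (F (\<Union>\<U>)). \<forall>W\<in>\<U>. res (\<Union>\<U>) W f = s W))"

text \<open>The natural morphism, on a class of pairs \<open>(g, \<alpha>)\<close>: the value at \<open>P\<close> is the common value of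
  \<open>g(P) / \<alpha>(P)\<close> over all representatives.\<close>

definition natural_map ::
  "(nat \<Rightarrow> 'k::field) set \<Rightarrow> (nat, 'k) mpoly set \<Rightarrow>
   ((nat, 'k) mpoly set \<times> (nat, 'k) mpoly set) set \<Rightarrow> (nat \<Rightarrow> 'k) \<Rightarrow> 'k" where
  "natural_map V h C = (\<lambda>P\<in>basic_open V h.
     the_elem ((\<lambda>(g, \<alpha>). coord_eval P g / coord_eval P \<alpha>) ` C))"

end

theory Submission
  imports Defs
begin

text \<open>
  Let \<open>f\<close> be regular on \<open>U = D\<^sub>V(h)\<close>.  The polynomials \<open>L\<close> such that \<open>f L\<close> agrees on \<open>U\<close> with a
  polynomial form an ideal \<open>J\<close>: multiplying a local denominator of \<open>f\<close> by a function vanishing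
  outside the neighbourhood where it is valid gives an element of \<open>J\<close>, so \<open>h\<close> vanishes on the zeros
  of \<open>J\<close>.  It remains to find an element of \<open>\<Sigma>\<^sub>h\<close> in \<open>J\<close>.  If the field is algebraically closed, a
  power of \<open>h\<close> will do by the Nullstellensatz.  Otherwise homogenizing a univariate polynomial
  without roots gives an anisotropic binary form, and iterating it on finitely many elements of \<open>J\<close>
  produces one \<open>p \<in> J\<close> with the same zeros as \<open>J\<close>.  Applied once more to \<open>p\<close> and \<open>1 - Y h\<close>, the form
  yields a polynomial \<open>D\<close> without zeros, and \<open>D\<^sup>#\<close> at \<open>(h X, 1, h)\<close> equals, where \<open>h \<noteq> 0\<close>, a power
  of \<open>h\<close> times a power of \<open>p\<close>, up to a nonzero constant.  Injectivity holds because \<open>h \<in> \<Sigma>\<^sub>h\<close>: a function that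
  vanishes on \<open>U\<close> is annihilated by \<open>h\<close>.
\<close>

text \<open>Over a field that is not algebraically closed, zeros in k^n say too little about an
  ideal: 1/(X^2 + 1) is regular on the real line although no power of 1 lies in the ideal (X^2 + 1).
  Hence powers of \<open>h\<close> do not suffice as denominators, and
  \<open>\<Sigma>\<^sub>h\<close> has to contain values of polynomials without rational zeros. Over
  an algebraically closed field such polynomials are constants and anisotropic binary forms do not
  exist, which is why the two cases need different tools. The form can absorb only finitely many
  elements, so \<open>J\<close> must be replaced by a finite subset; this subset need not generate
  \<open>J\<close>, because only its zeros matter. The element \<open>p\<close> alone may still
  vanish where \<open>h\<close> does. The second argument 1 - Y h is the Rabinowitsch trick: it
  excludes exactly these zeros, and it vanishes at Y = 1/h. Homogenizing then clears the
  denominator, as (h X, 1) divided by h is (X, 1/h).\<close>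

section \<open>Dickson's lemma\<close>

text \<open>The minima of the tails of \<open>f\<close> are nondecreasing; the subsequence visits
  positions where they are attained.\<close>

lemma seq_nat_mono_subseq:
  fixes f :: "nat \<Rightarrow> nat"
  shows "\<exists>r :: nat \<Rightarrow> nat. strict_mono r \<and> mono (f \<circ> r)"
proof -
  define m where "m i = (LEAST v. \<exists>j\<ge>i. f j = v)" for i
  have ex: "\<exists>j\<ge>i. f j = m i" for i
    unfolding m_def by (rule LeastI[of _ "f i"]) auto
  have le: "m i \<le> f j" if "i \<le> j" for i j
    unfolding m_def by (rule Least_le) (use that in auto)
  have m_mono: "m i \<le> m j" if "i \<le> j" for i j
  proof -
    obtain k where "k \<ge> j" "f k = m j" using ex by blast
    then show ?thesis using le[of i k] that by simp
  qed
  define s where "s i = (SOME j. j \<ge> i \<and> f j = m i)" for i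
  have s: "s i \<ge> i" "f (s i) = m i" for i
    using someI_ex[OF ex[of i], folded s_def] by auto
  \<comment> \<open>\<open>Suc x\<close> makes the next tail start beyond the position just chosen,
    so \<open>r\<close> is strictly increasing.\<close>
  define r where "r = rec_nat (s 0) (\<lambda>_ x. s (Suc x))"
  have r_Suc: "r (Suc i) = s (Suc (r i))" for i by (simp add: r_def)
  have "strict_mono r"
    unfolding strict_mono_Suc_iff r_Suc using s(1) Suc_le_lessD by blast
  moreover have "f (r i) \<le> f (r (Suc i))" for i
  proof (cases i)
    case 0
    then show ?thesis using s(1)[of "Suc (r 0)"]
      using m_mono[of 0 "Suc (r 0)"] by (simp add: r_Suc s(2)) (simp add: r_def s(2))
  next
    case (Suc j)
    have "f (r i) = m (Suc (r j))" by (simp add: Suc r_Suc s(2))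
    moreover have "Suc (r j) \<le> r (Suc i)"
      using s(1)[of "Suc (r j)"] s(1)[of "Suc (r i)"] by (simp add: Suc r_Suc)
    ultimately show ?thesis by (simp add: le)
  qed
  ultimately show ?thesis
    by (auto simp: mono_iff_le_Suc)
qed

text \<open>A subsequence of a monotone sequence is monotone, so the coordinates can be treated one
  after the other.\<close>

lemma dickson_subseq:
  fixes s :: "nat \<Rightarrow> nat \<Rightarrow> nat"
  shows "\<exists>r :: nat \<Rightarrow> nat. strict_mono r \<and> (\<forall>v<n. mono (\<lambda>i. s (r i) v))"
proof (induction n)
  case 0
  show ?case by (intro exI[of _ "id :: nat \<Rightarrow> nat"]) (simp add: strict_mono_def)
next
  case (Suc n)
  then obtain r :: "nat \<Rightarrow> nat" where r: "strict_mono r" "\<forall>v<n. mono (\<lambda>i. s (r i) v)" by blast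
  obtain t :: "nat \<Rightarrow> nat" where t: "strict_mono t" "mono ((\<lambda>i. s (r i) n) \<circ> t)"
    using seq_nat_mono_subseq by blast
  have "mono (\<lambda>i. s (r (t i)) v)" if "v < Suc n" for v
    using that r(2) t strict_mono_mono[OF t(1)] by (auto simp: less_Suc_eq mono_def)
  then show ?case
    using strict_mono_o[OF r(1) t(1)] by (intro exI[of _ "r \<circ> t"]) (auto simp: o_def)
qed

lemma dickson:
  fixes s :: "nat \<Rightarrow> (nat \<Rightarrow>\<^sub>0 nat)"
  assumes "\<And>i. Poly_Mapping.keys (s i) \<subseteq> {..<n}"
  shows "\<exists>i j d. i < j \<and> s j = s i + d"
proof -
  obtain r :: "nat \<Rightarrow> nat" where r: "strict_mono r" "\<forall>v<n. mono (\<lambda>i. Poly_Mapping.lookup (s (r i)) v)"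
    using dickson_subseq[of n "\<lambda>i. Poly_Mapping.lookup (s i)"] by blast
  have "Poly_Mapping.lookup (s (r 0)) v \<le> Poly_Mapping.lookup (s (r 1)) v" for v
  proof (cases "v < n")
    case True
    then show ?thesis using r(2) monoD[of "\<lambda>i. Poly_Mapping.lookup (s (r i)) v" 0 1] by simp
  next
    case False
    then have "v \<notin> Poly_Mapping.keys (s (r 0))" using assms by auto
    then show ?thesis by (simp add: in_keys_iff)
  qed
  \<comment> \<open>Subtraction of exponents is truncated; the inequality just proved makes it
    exact.\<close>
  then have "s (r 1) = s (r 0) + (s (r 1) - s (r 0))"
    by (intro poly_mapping_eqI) (simp add: lookup_add lookup_minus)
  moreover have "r 0 < r 1" using r(1) by (simp add: strict_mono_def)
  ultimately show ?thesis by blast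
qed

section \<open>Lexicographic order on monomials\<close>

lemma monomial_nonneg: "(0 :: nat \<Rightarrow>\<^sub>0 nat) \<le> d"
proof (cases "d = 0")
  case False
  then have "Poly_Mapping.keys d \<noteq> {}" by simp
  \<comment> \<open>The order compares exponents at the first variable where they differ; for 0 and
    \<open>d\<close> this is the least variable of \<open>d\<close>.\<close>
  define k where "k = Min (Poly_Mapping.keys d)"
  have "k \<in> Poly_Mapping.keys d" using \<open>Poly_Mapping.keys d \<noteq> {}\<close> by (simp add: k_def)
  moreover have "v \<notin> Poly_Mapping.keys d" if "v < k" for v
    using that Min_le[of "Poly_Mapping.keys d" v] unfolding k_def by (meson finite_keys leD)
  ultimately have "less_fun (Poly_Mapping.lookup 0) (Poly_Mapping.lookup d)"
    by (intro less_funI exI[of _ k]) (auto simp: in_keys_iff)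
  then show ?thesis by (simp add: less_eq_poly_mapping.rep_eq)
qed simp

text \<open>Without the bound on the variables the order is not well founded: the variables
  themselves form a descending chain. With it, Dickson's lemma makes a later member of a descending
  chain a multiple of an earlier one, hence not smaller.\<close>

lemma wf_monomials:
  "wf {(a, b :: nat \<Rightarrow>\<^sub>0 nat). a < b \<and> Poly_Mapping.keys a \<subseteq> {..<n} \<and> Poly_Mapping.keys b \<subseteq> {..<n}}"
  unfolding wf_iff_no_infinite_down_chain
proof safe
  fix s :: "nat \<Rightarrow> (nat \<Rightarrow>\<^sub>0 nat)"
  assume s: "\<forall>i. (s (Suc i), s i) \<in> {(a, b). a < b \<and>
    Poly_Mapping.keys a \<subseteq> {..<n} \<and> Poly_Mapping.keys b \<subseteq> {..<n}}"
  then have "Poly_Mapping.keys (s i) \<subseteq> {..<n}" for i by blast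
  then obtain i j d where "i < j" "s j = s i + d" using dickson[of s n] by meson
  moreover have "s j < s i"
    using \<open>i < j\<close> by (induction rule: less_Suc_induct) (use s in auto)
  ultimately show False using monomial_nonneg[of d]
    using add_left_mono[of 0 d "s i"] by simp
qed

section \<open>The polynomial ring\<close>

lemma carrier_poly_algebra:
  "p \<in> carrier (poly_algebra n) \<longleftrightarrow> (\<forall>m\<in>Poly_Mapping.keys p. Poly_Mapping.keys m \<subseteq> {..<n})"
  by (simp add: poly_algebra_def)

lemma poly_algebra_simps [simp]:
  "\<zero>\<^bsub>poly_algebra n\<^esub> = 0" "\<one>\<^bsub>poly_algebra n\<^esub> = 1"
  "x \<oplus>\<^bsub>poly_algebra n\<^esub> y = x + y" "x \<otimes>\<^bsub>poly_algebra n\<^esub> y = x * y"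
  "c \<odot>\<^bsub>poly_algebra n\<^esub> x = Const c * x"
  by (simp_all add: poly_algebra_def)

lemma poly_algebra_add: "\<lbrakk>p \<in> carrier (poly_algebra n); q \<in> carrier (poly_algebra n)\<rbrakk> \<Longrightarrow>
    p + q \<in> carrier (poly_algebra n)"
  using keys_add[of p q] by (auto simp: carrier_poly_algebra)

lemma poly_algebra_uminus: "p \<in> carrier (poly_algebra n) \<Longrightarrow> - p \<in> carrier (poly_algebra n)"
  by (simp add: carrier_poly_algebra)

lemma poly_algebra_diff: "\<lbrakk>p \<in> carrier (poly_algebra n); q \<in> carrier (poly_algebra n)\<rbrakk> \<Longrightarrow>
    p - q \<in> carrier (poly_algebra n)"
  using poly_algebra_add[of p n "- q"] poly_algebra_uminus[of q n] by simp

lemma poly_algebra_mult: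
  assumes "p \<in> carrier (poly_algebra n)" "q \<in> carrier (poly_algebra n)"
  shows "p * q \<in> carrier (poly_algebra n)"
  unfolding carrier_poly_algebra
proof
  fix m assume "m \<in> Poly_Mapping.keys (p * q)"
  then obtain a b where "a \<in> Poly_Mapping.keys p" "b \<in> Poly_Mapping.keys q" "m = a + b"
    using keys_mult[of p q] by blast
  then show "Poly_Mapping.keys m \<subseteq> {..<n}"
    using assms keys_add[of a b] unfolding carrier_poly_algebra by fastforce
qed

lemma poly_algebra_Const: "Const c \<in> carrier (poly_algebra n)"
  by (simp add: carrier_poly_algebra Const_def)

lemma poly_algebra_0: "0 \<in> carrier (poly_algebra n)"
  by (simp add: carrier_poly_algebra)

lemma poly_algebra_1: "1 \<in> carrier (poly_algebra n)"
  by (simp add: carrier_poly_algebra)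

lemma poly_algebra_Var: "v < n \<Longrightarrow> Var v \<in> carrier (poly_algebra n)"
  by (simp add: carrier_poly_algebra Var_def)

lemma poly_algebra_power: "p \<in> carrier (poly_algebra n) \<Longrightarrow> p ^ k \<in> carrier (poly_algebra n)"
  by (induction k) (simp_all add: poly_algebra_1 poly_algebra_mult)

lemma poly_algebra_sum:
  "(\<And>i. i \<in> I \<Longrightarrow> f i \<in> carrier (poly_algebra n)) \<Longrightarrow> sum f I \<in> carrier (poly_algebra n)"
  by (induction I rule: infinite_finite_induct) (auto simp: poly_algebra_0 poly_algebra_add)

lemmas poly_algebra_closed = poly_algebra_0 poly_algebra_1 poly_algebra_Const poly_algebra_Var
  poly_algebra_add poly_algebra_uminus poly_algebra_diff poly_algebra_mult poly_algebra_power
  poly_algebra_sum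

lemma poly_algebra_mono: "m \<le> n \<Longrightarrow> carrier (poly_algebra m) \<subseteq> carrier (poly_algebra n)"
  by (fastforce simp: carrier_poly_algebra)

lemma cring_poly_algebra: "cring (poly_algebra n :: ('k::field, (nat, 'k) mpoly) module)"
proof (rule cringI)
  show "abelian_group (poly_algebra n :: ('k, (nat, 'k) mpoly) module)"
  proof (rule abelian_groupI)
    fix x :: "(nat, 'k) mpoly" assume "x \<in> carrier (poly_algebra n)"
    then show "\<exists>y\<in>carrier (poly_algebra n). y \<oplus>\<^bsub>poly_algebra n\<^esub> x = \<zero>\<^bsub>poly_algebra n\<^esub>"
      by (intro bexI[of _ "- x"]) (auto simp: poly_algebra_uminus)
  qed (auto simp: poly_algebra_closed algebra_simps)
  show "comm_monoid (poly_algebra n :: ('k, (nat, 'k) mpoly) module)"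
    by (rule comm_monoidI) (auto simp: poly_algebra_closed algebra_simps)
qed (auto simp: algebra_simps)

lemma poly_algebra_inv:
  assumes "p \<in> carrier (poly_algebra n)" shows "\<ominus>\<^bsub>poly_algebra n\<^esub> p = - p"
proof -
  interpret cring "poly_algebra n :: ('a, (nat, 'a) mpoly) module" by (rule cring_poly_algebra)
  show ?thesis using minus_equality[of "- p" p] assms by (simp add: poly_algebra_uminus)
qed

text \<open>Closure under negation is absent because multiplication by -1 supplies it.\<close>

lemma ideal_poly_algebra_iff:
  "ideal J (poly_algebra n) \<longleftrightarrow> J \<subseteq> carrier (poly_algebra n) \<and> 0 \<in> J \<and>
     (\<forall>p\<in>J. \<forall>q\<in>J. p + q \<in> J) \<and> (\<forall>p\<in>J. \<forall>q\<in>carrier (poly_algebra n). q * p \<in> J)" (is "_ = ?R")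
proof
  assume "ideal J (poly_algebra n)"
  then interpret ideal J "poly_algebra n" .
  show ?R
    using a_subset additive_subgroup.zero_closed[OF additive_subgroup_axioms]
      additive_subgroup.a_closed[OF additive_subgroup_axioms] I_l_closed by simp
next
  interpret cring "poly_algebra n :: ('a, (nat, 'a) mpoly) module" by (rule cring_poly_algebra)
  assume R: ?R
  show "ideal J (poly_algebra n)"
  proof (rule idealI)
    show "subgroup J (add_monoid (poly_algebra n))"
    proof (rule group.subgroupI[OF a_group])
      fix a assume "a \<in> J"
      then have "(- 1) * a \<in> J" using R poly_algebra_uminus[OF poly_algebra_1] by blast
      then show "inv\<^bsub>add_monoid (poly_algebra n)\<^esub> a \<in> J"
        using poly_algebra_inv[of a n] \<open>a \<in> J\<close> R by (auto simp: a_inv_def)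
    qed (use R in auto)
  qed (use R in \<open>auto simp: ring_axioms mult.commute\<close>)
qed

lemma ideal_poly_algebra_diff:
  assumes "ideal J (poly_algebra n)" "p \<in> J" "q \<in> J"
  shows "p - q \<in> J"
proof -
  have "(- 1) * q \<in> J"
    using assms poly_algebra_uminus[OF poly_algebra_1] unfolding ideal_poly_algebra_iff by blast
  then have "p + (- 1) * q \<in> J" using assms unfolding ideal_poly_algebra_iff by blast
  then show ?thesis by simp
qed

section \<open>Evaluation at a point\<close>

lemma mpoly_eval_0 [simp]: "mpoly_eval P 0 = 0"
  by (simp add: mpoly_eval_def)

lemma mpoly_eval_Const [simp]: "mpoly_eval P (Const c) = c"
  by (simp add: Const_def mpoly_eval_single)

lemma Const_1: "Const 1 = 1"
  by (simp add: Const_def)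

lemma mpoly_eval_1 [simp]: "mpoly_eval P 1 = 1"
  using mpoly_eval_Const[of P 1] by (simp add: Const_1)

lemma mpoly_eval_Var [simp]: "mpoly_eval P (Var v) = P v"
  by (simp add: Var_def mpoly_eval_single)

lemma mpoly_eval_uminus: "mpoly_eval P (- p) = - mpoly_eval P p"
  using mpoly_eval_add[of P p "- p"] by (simp add: eq_neg_iff_add_eq_0 add.commute)

lemma mpoly_eval_diff: "mpoly_eval P (p - q) = mpoly_eval P p - mpoly_eval P q"
  using mpoly_eval_add[of P p "- q"] by (simp add: mpoly_eval_uminus)

lemma mpoly_eval_power: "mpoly_eval P (p ^ k) = mpoly_eval P p ^ k"
  by (induction k) (simp_all add: mpoly_eval_mult)

lemma mpoly_eval_prod: "mpoly_eval P (prod f C) = (\<Prod>x\<in>C. mpoly_eval P (f x))"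
  by (induction C rule: infinite_finite_induct) (simp_all add: mpoly_eval_mult)

lemmas mpoly_eval_simps = mpoly_eval_add mpoly_eval_mult mpoly_eval_uminus mpoly_eval_diff
  mpoly_eval_power mpoly_eval_prod mpoly_eval_sum

text \<open>Lets a point be changed outside the first \<open>n\<close> coordinates: cut down to a
  member of \<open>affine_space\<close>, or extended by a value for one more variable.\<close>

lemma mpoly_eval_cong:
  assumes "p \<in> carrier (poly_algebra n)" "\<And>v. v < n \<Longrightarrow> P v = Q v"
  shows "mpoly_eval P p = mpoly_eval Q p"
  unfolding mpoly_eval_def using assms
  by (intro sum.cong prod.cong refl arg_cong2[of _ _ _ _ "(*)"] arg_cong2[of _ _ _ _ "(^)"])
     (auto simp: carrier_poly_algebra)

text \<open>Translation by \<open>m\<close> is injective on monomials, so no two terms of the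
  product collide.\<close>

lemma lookup_single_mult:
  fixes p :: "('v, 'k::field) mpoly"
  shows "Poly_Mapping.lookup (Poly_Mapping.single m c * p) (m + l) = c * Poly_Mapping.lookup p l"
proof -
  have "p = (\<Sum>k\<in>Poly_Mapping.keys p. Poly_Mapping.single k (Poly_Mapping.lookup p k))"
    by (rule poly_mapping_eqI) (auto simp: lookup_sum lookup_single when_def in_keys_iff)
  then have "Poly_Mapping.single m c * p =
      (\<Sum>k\<in>Poly_Mapping.keys p. Poly_Mapping.single (m + k) (c * Poly_Mapping.lookup p k))"
    by (metis (no_types, lifting) mult_single sum.cong sum_distrib_left)
  then show ?thesis
    by (auto simp: lookup_sum lookup_single when_def in_keys_iff)
qed

section \<open>Noetherianity of the Zariski topology\<close>

text \<open>For use after the term at \<open>l\<close> has been cancelled: the leading monomial has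
  then dropped strictly.\<close>

lemma Max_keys_less:
  fixes p :: "(nat, 'k::field) mpoly"
  assumes "p \<noteq> 0" "\<And>m. m \<in> Poly_Mapping.keys p \<Longrightarrow> m \<le> l" "Poly_Mapping.lookup p l = 0"
  shows "Max (Poly_Mapping.keys p) < l"
proof -
  have "Max (Poly_Mapping.keys p) \<in> Poly_Mapping.keys p" using assms(1) by (intro Max_in) auto
  then show ?thesis using assms(2,3) by (metis in_keys_iff order_le_less)
qed

text \<open>A zero-set version of Buchberger's argument: pick polynomials of \<open>J\<close> that do not vanish on
  the common zeros of their predecessors, each with minimal leading monomial for the
  lexicographic order; Dickson's lemma makes some leading monomial divide a later one.\<close>

theorem finite_subset_same_zero_set:
  fixes J :: "(nat, 'k::field) mpoly set"
  assumes J: "ideal J (poly_algebra n)"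
  shows "\<exists>G\<subseteq>J. finite G \<and> zero_set n G = zero_set n J"
proof (rule ccontr)
  assume "\<not> ?thesis"
  then have neq: "zero_set n G \<noteq> zero_set n J" if "G \<subseteq> J" "finite G" for G using that by blast
  define lm where "lm p = Max (Poly_Mapping.keys p)" for p :: "(nat, 'k) mpoly"
  \<comment> \<open>These elements of \<open>J\<close> witness that \<open>G\<close> still has too
    many zeros.\<close>
  define bad where "bad G = {f \<in> J. \<exists>P\<in>zero_set n G. mpoly_eval P f \<noteq> 0}" for G
  have J_carrier: "J \<subseteq> carrier (poly_algebra n)" using J by (simp add: ideal_poly_algebra_iff)
  have bad_nonempty: "bad G \<noteq> {}" if sub: "G \<subseteq> J" "finite G" for G
  proof -
    have "zero_set n J \<subseteq> zero_set n G" using sub(1) by (auto simp: zero_set_def)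
    then obtain P where P: "P \<in> zero_set n G" "P \<notin> zero_set n J" using neq[OF sub] by blast
    then obtain f where "f \<in> J" "mpoly_eval P f \<noteq> 0" by (auto simp: zero_set_def)
    then show ?thesis using P by (auto simp: bad_def)
  qed
  have bad_neq_0: "f \<noteq> 0" if "f \<in> bad G" for f G using that by (auto simp: bad_def)
  have lm_in: "lm f \<in> Poly_Mapping.keys f" if "f \<noteq> 0" for f
    unfolding lm_def using that by (intro Max_in) auto
  have lm_keys: "Poly_Mapping.keys (lm f) \<subseteq> {..<n}" if "f \<in> bad G" for f G
    using lm_in[OF bad_neq_0[OF that]] that J_carrier unfolding bad_def carrier_poly_algebra[abs_def]
    by (metis (no_types, lifting) carrier_poly_algebra mem_Collect_eq subsetD)
  have "\<exists>f\<in>bad G. \<forall>g\<in>bad G. \<not> lm g < lm f" if sub: "G \<subseteq> J" "finite G" for G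
  proof -
    obtain m where m: "m \<in> lm ` bad G" and
      min: "\<And>m'. (m', m) \<in> {(a, b). a < b \<and> Poly_Mapping.keys a \<subseteq> {..<n} \<and>
        Poly_Mapping.keys b \<subseteq> {..<n}} \<Longrightarrow> m' \<notin> lm ` bad G"
      using wfE_min[OF wf_monomials[of n], of _ "lm ` bad G"] bad_nonempty[OF sub]
      by (metis (no_types, lifting) ex_in_conv image_is_empty)
    from m obtain f where f: "f \<in> bad G" "m = lm f" by blast
    show ?thesis using f min lm_keys by (intro bexI[of _ f]) blast+
  qed
  then have "\<forall>G. \<exists>f. G \<subseteq> J \<and> finite G \<longrightarrow> f \<in> bad G \<and> (\<forall>g\<in>bad G. \<not> lm g < lm f)"
    by blast
  then obtain c where c_min: "\<forall>G. G \<subseteq> J \<and> finite G \<longrightarrow>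
      c G \<in> bad G \<and> (\<forall>g\<in>bad G. \<not> lm g < lm (c G))"
    by (rule choice[THEN exE])
  have c: "c G \<in> bad G" "\<And>g. g \<in> bad G \<Longrightarrow> \<not> lm g < lm (c G)"
    if "G \<subseteq> J" "finite G" for G
    using c_min that by blast+
  define G where "G = rec_nat {} (\<lambda>_ G. insert (c G) G)"
  have G_Suc: "G (Suc i) = insert (c (G i)) (G i)" for i by (simp add: G_def)
  have G: "finite (G i) \<and> G i \<subseteq> J" for i
  proof (induction i)
    case (Suc i)
    then have "c (G i) \<in> J" using c(1) by (auto simp: bad_def)
    with Suc show ?case by (simp add: G_Suc)
  qed (simp add: G_def)
  define f where "f i = c (G i)" for i
  have f: "f i \<in> bad (G i)" for i using c(1) G by (simp add: f_def)
  have f_in_G: "f i \<in> G j" if "i < j" for i j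
    using that
  proof (induction j)
    case (Suc j) then show ?case by (cases "i = j") (auto simp: G_Suc f_def)
  qed simp
  obtain i j d where ij: "i < j" "lm (f j) = lm (f i) + d"
    using dickson[of "\<lambda>i. lm (f i)" n] lm_keys[OF f] by blast
  \<comment> \<open>The quotient of the leading coefficients: subtracting \<open>t\<close> cancels
    the leading term of \<open>f j\<close>.\<close>
  define a where "a = Poly_Mapping.lookup (f j) (lm (f j)) / Poly_Mapping.lookup (f i) (lm (f i))"
  define t where "t = Poly_Mapping.single d a * f i"
  define g where "g = f j - t"
  have fi0: "Poly_Mapping.lookup (f i) (lm (f i)) \<noteq> 0"
    using lm_in[OF bad_neq_0[OF f]] by (simp add: in_keys_iff)
  have "Poly_Mapping.keys d \<subseteq> Poly_Mapping.keys (lm (f j))"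
    unfolding ij(2) by (auto simp: in_keys_iff lookup_add)
  then have "Poly_Mapping.single d a \<in> carrier (poly_algebra n)"
    using lm_keys[OF f[of j]] by (auto simp: carrier_poly_algebra)
  then have "t \<in> J"
    using J f[of i] unfolding t_def ideal_poly_algebra_iff bad_def by blast
  then have "g \<in> J"
    using ideal_poly_algebra_diff[OF J] f[of j] by (auto simp: g_def bad_def)
  moreover obtain P where P: "P \<in> zero_set n (G j)" "mpoly_eval P (f j) \<noteq> 0"
    using f[of j] by (auto simp: bad_def)
  \<comment> \<open>\<open>f i\<close> is among the predecessors collected in \<open>G j\<close>, so
    the subtraction leaves the nonzero value at \<open>P\<close> unchanged. Thus \<open>g\<close>
    competes with \<open>f j\<close> and has a smaller leading monomial.\<close>
  moreover have "mpoly_eval P (f i) = 0" using P(1) f_in_G[OF ij(1)] by (simp add: zero_set_def)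
  then have "mpoly_eval P g \<noteq> 0"
    using P(2) by (simp add: g_def t_def mpoly_eval_simps)
  ultimately have g: "g \<in> bad (G j)" by (auto simp: bad_def)
  have "lm g < lm (f j)" unfolding lm_def[of g]
  proof (rule Max_keys_less)
    show "g \<noteq> 0" by (rule bad_neq_0[OF g])
    fix m assume "m \<in> Poly_Mapping.keys g"
    then have "m \<in> Poly_Mapping.keys (f j) \<or> m \<in> Poly_Mapping.keys t"
      using keys_diff[of "f j" t] by (auto simp: g_def)
    moreover have "m \<le> lm (f j)" if "m \<in> Poly_Mapping.keys t"
    proof -
      have "\<exists>l\<in>Poly_Mapping.keys (f i). m = d + l"
        using that keys_mult[of "Poly_Mapping.single d a" "f i"]
        by (auto simp: t_def split: if_splits)
      then obtain l where l: "l \<in> Poly_Mapping.keys (f i)" "m = d + l" by blast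
      then have "l \<le> lm (f i)" by (simp add: lm_def)
      then show ?thesis by (simp add: l(2) ij(2) add.commute add_left_mono)
    qed
    ultimately show "m \<le> lm (f j)" by (auto simp: lm_def)
  next
    have "Poly_Mapping.lookup t (lm (f j)) = a * Poly_Mapping.lookup (f i) (lm (f i))"
      unfolding t_def ij(2) add.commute[of "lm (f i)"] by (rule lookup_single_mult)
    then show "Poly_Mapping.lookup g (lm (f j)) = 0"
      using fi0 by (simp add: g_def lookup_minus a_def)
  qed
  then show False using c(2)[of "G j" g] G g by (simp add: f_def)
qed

section \<open>Fields that are not algebraically closed\<close>

text \<open>For nonzero y the sum is y^d times the value of \<open>q\<close> at x/y, which is never
  0; for y = 0 only the leading term survives.\<close>

lemma homogenized_rootless_eq_0_iff:
  fixes q :: "'k::field poly"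
  assumes deg: "Polynomial.degree q > 0" and rootless: "\<And>t. poly q t \<noteq> 0"
  shows "(\<Sum>i\<le>Polynomial.degree q. Polynomial.coeff q i * x ^ i * y ^ (Polynomial.degree q - i)) = 0
    \<longleftrightarrow> x = 0 \<and> y = 0" (is "?s = 0 \<longleftrightarrow> _")
proof (cases "y = 0")
  case True
  have "?s = (\<Sum>i\<in>{Polynomial.degree q}. Polynomial.coeff q i * x ^ i * y ^ (Polynomial.degree q - i))"
    by (rule sum.mono_neutral_right) (auto simp: True)
  then show ?thesis using deg True by auto
next
  case False
  have "?s = y ^ Polynomial.degree q * poly q (x / y)"
    unfolding poly_altdef sum_distrib_left
    by (rule sum.cong) (auto simp: False power_divide power_diff field_simps)
  then show ?thesis using rootless False by simp
qed

text \<open>The binary form belonging to \<open>q\<close>, at two polynomials. For X^2 + 1 over the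
  reals it is f^2 + g^2: a single equation that expresses two.\<close>

definition rootless_form :: "'k::field poly \<Rightarrow> ('v, 'k) mpoly \<Rightarrow> ('v, 'k) mpoly \<Rightarrow> ('v, 'k) mpoly" where
  "rootless_form q f g = (\<Sum>i\<le>Polynomial.degree q.
     Const (Polynomial.coeff q i) * f ^ i * g ^ (Polynomial.degree q - i))"

lemma mpoly_eval_rootless_form_eq_0_iff:
  assumes "Polynomial.degree q > 0" "\<And>t. poly q t \<noteq> 0"
  shows "mpoly_eval P (rootless_form q f g) = 0 \<longleftrightarrow> mpoly_eval P f = 0 \<and> mpoly_eval P g = 0"
  unfolding rootless_form_def mpoly_eval_simps mpoly_eval_Const
  by (rule homogenized_rootless_eq_0_iff) (use assms in auto)

lemma poly_algebra_rootless_form: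
  "\<lbrakk>f \<in> carrier (poly_algebra n); g \<in> carrier (poly_algebra n)\<rbrakk> \<Longrightarrow>
     rootless_form q f g \<in> carrier (poly_algebra n)"
  unfolding rootless_form_def by (intro poly_algebra_closed)

lemma ideal_poly_algebra_sum:
  assumes "ideal J (poly_algebra n)" "\<And>i. i \<in> I \<Longrightarrow> f i \<in> J"
  shows "sum f I \<in> J"
  using assms(2)
proof (induction I rule: infinite_finite_induct)
qed (use assms(1) in \<open>auto simp: ideal_poly_algebra_iff\<close>)

lemma ideal_poly_algebra_power:
  assumes J: "ideal J (poly_algebra n)" and "p \<in> J" "k > 0"
  shows "p ^ k \<in> J"
proof -
  have "p \<in> carrier (poly_algebra n)" using assms by (auto simp: ideal_poly_algebra_iff)
  then have "p ^ (k - 1) \<in> carrier (poly_algebra n)" by (rule poly_algebra_power)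
  then have "p ^ (k - 1) * p \<in> J" using J \<open>p \<in> J\<close> unfolding ideal_poly_algebra_iff by blast
  then show ?thesis using \<open>k > 0\<close> by (simp add: power_eq_if mult.commute)
qed

text \<open>As the form has positive degree, every term contains \<open>f\<close> or
  \<open>g\<close> to a positive power.\<close>

lemma ideal_rootless_form:
  assumes J: "ideal J (poly_algebra n)" and fg: "f \<in> J" "g \<in> J" and deg: "Polynomial.degree q > 0"
  shows "rootless_form q f g \<in> J"
  unfolding rootless_form_def
proof (rule ideal_poly_algebra_sum[OF J])
  fix i
  have l: "u * v \<in> J" if "u \<in> carrier (poly_algebra n)" "v \<in> J" for u v
    using J that unfolding ideal_poly_algebra_iff by blast
  have A: "f \<in> carrier (poly_algebra n)" "g \<in> carrier (poly_algebra n)"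
    using J fg unfolding ideal_poly_algebra_iff by blast+
  let ?d = "Polynomial.degree q"
  show "Const (Polynomial.coeff q i) * f ^ i * g ^ (?d - i) \<in> J"
  proof (cases "i = 0")
    case True
    then show ?thesis using deg fg
      by (intro l poly_algebra_closed A ideal_poly_algebra_power[OF J]) auto
  next
    case False
    then have "(Const (Polynomial.coeff q i) * g ^ (?d - i)) * f ^ i \<in> J" using fg
      by (intro l poly_algebra_closed A ideal_poly_algebra_power[OF J]) auto
    then show ?thesis by (simp add: mult_ac)
  qed
qed

text \<open>The form is nested along a finite set of equations; the empty set starts with the
  polynomial 0, whose zeros are the whole space.\<close>

lemma single_poly_same_zero_set:
  fixes q :: "'k::field poly" and J :: "(nat, 'k) mpoly set"
  assumes J: "ideal J (poly_algebra n)"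
    and deg: "Polynomial.degree q > 0" and rootless: "\<And>t. poly q t \<noteq> 0"
  shows "\<exists>p\<in>J. zero_set n {p} = zero_set n J"
proof -
  obtain G where G: "finite G" "G \<subseteq> J" "zero_set n G = zero_set n J"
    using finite_subset_same_zero_set[OF J] by blast
  have "\<exists>p\<in>J. zero_set n {p} = zero_set n G"
    using G(1,2)
  proof (induction G)
    case empty
    then show ?case using J
      by (intro bexI[of _ 0]) (auto simp: zero_set_def ideal_poly_algebra_iff)
  next
    case (insert g G)
    then obtain p where p: "p \<in> J" "zero_set n {p} = zero_set n G" by auto
    have "zero_set n {rootless_form q g p} = zero_set n {g} \<inter> zero_set n {p}"
      unfolding zero_set_def by (auto simp: mpoly_eval_rootless_form_eq_0_iff[OF deg rootless])
    also have "\<dots> = zero_set n (insert g G)" unfolding p(2) by (auto simp: zero_set_def)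
    finally show ?case
      using ideal_rootless_form[OF J _ p(1) deg, of g] insert.prems by auto
  qed
  then show ?thesis using G(3) by simp
qed

text \<open>A zero of \<open>D\<close> would be a zero of \<open>p\<close>, hence of
  \<open>J\<close> and of \<open>H\<close>, against 1 = \<open>X\<^sub>n H\<close>. At
  \<open>X\<^sub>n\<close> = 1/H the second argument of the form is 0, and what remains is a
  constant times a power of \<open>p\<close>; this is \<open>L\<close>.\<close>

lemma signature_element_rootless:
  fixes q :: "'k::field poly" and H :: "(nat, 'k) mpoly" and J :: "(nat, 'k) mpoly set"
  assumes J: "ideal J (poly_algebra n)" and H: "H \<in> carrier (poly_algebra n)"
    and sub: "zero_set n J \<subseteq> zero_set n {H}"
    and deg: "Polynomial.degree q > 0" and rootless: "\<And>t. poly q t \<noteq> 0"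
  shows "\<exists>D\<in>alg_signature \<inter> carrier (poly_algebra (Suc n)). \<exists>L\<in>J. \<forall>P. mpoly_eval P H \<noteq> 0 \<longrightarrow>
    mpoly_eval (P(n := 1 / mpoly_eval P H)) D = mpoly_eval P L"
proof -
  obtain p where p: "p \<in> J" "zero_set n {p} = zero_set n J"
    using single_poly_same_zero_set[OF J deg rootless] by blast
  have pA: "p \<in> carrier (poly_algebra n)" using J p(1) unfolding ideal_poly_algebra_iff by blast
  have up: "f \<in> carrier (poly_algebra (Suc n))" if "f \<in> carrier (poly_algebra n)"
    for f :: "(nat, 'k) mpoly"
    using that poly_algebra_mono[of n "Suc n"] by auto
  have upd: "mpoly_eval (P(n := t)) f = mpoly_eval P f" if "f \<in> carrier (poly_algebra n)"
    for P t and f :: "(nat, 'k) mpoly"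
    by (rule mpoly_eval_cong[OF that]) auto
  define D where "D = rootless_form q p (1 - Var n * H)"
  let ?d = "Polynomial.degree q"
  define L where "L = Const (lead_coeff q) * p ^ ?d"
  have "D \<in> carrier (poly_algebra (Suc n))"
    unfolding D_def by (intro poly_algebra_rootless_form poly_algebra_closed up[OF pA] up[OF H]) auto
  moreover have "mpoly_eval P D \<noteq> 0" for P
  proof
    assume "mpoly_eval P D = 0"
    then have 0: "mpoly_eval P p = 0" "1 = P n * mpoly_eval P H"
      unfolding D_def mpoly_eval_rootless_form_eq_0_iff[OF deg rootless]
      by (auto simp: mpoly_eval_simps)
    \<comment> \<open>Assignments are total, whereas members of \<open>zero_set n\<close> must be
      \<open>undefined\<close> from \<open>n\<close> on.\<close>
    let ?Q = "restrict P {..<n}"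
    have "?Q \<in> zero_set n {p}"
      using 0(1) mpoly_eval_cong[OF pA, of ?Q P] by (simp add: zero_set_def affine_space_def)
    then have "mpoly_eval ?Q H = 0" using p(2) sub by (auto simp: zero_set_def)
    then show False using 0(2) mpoly_eval_cong[OF H, of ?Q P] by simp
  qed
  moreover have "L \<in> J"
    using ideal_poly_algebra_power[OF J p(1) deg] poly_algebra_Const J
    unfolding L_def ideal_poly_algebra_iff by blast
  moreover have "mpoly_eval (P(n := 1 / mpoly_eval P H)) D = mpoly_eval P L"
    if "mpoly_eval P H \<noteq> 0" for P
  proof -
    let ?Q = "P(n := 1 / mpoly_eval P H)"
    have 0: "mpoly_eval ?Q (1 - Var n * H) = 0"
      using that by (simp add: mpoly_eval_simps upd[OF H])
    have "mpoly_eval ?Q D = (\<Sum>i\<le>?d. Polynomial.coeff q i * mpoly_eval P p ^ i * 0 ^ (?d - i))"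
      by (simp only: D_def rootless_form_def mpoly_eval_sum mpoly_eval_mult mpoly_eval_power 0
          mpoly_eval_Const upd[OF pA])
    \<comment> \<open>Only the index \<open>?d\<close> escapes the factor 0, because 0 ^ 0 =
      1.\<close>
    also have "\<dots> = (\<Sum>i\<in>{?d}. Polynomial.coeff q i * mpoly_eval P p ^ i * 0 ^ (?d - i))"
      by (rule sum.mono_neutral_right) auto
    finally show ?thesis by (simp add: L_def mpoly_eval_simps)
  qed
  ultimately show ?thesis by (auto simp: alg_signature_def)
qed

section \<open>The Nullstellensatz over an algebraically closed field\<close>

definition polys_over :: "nat \<Rightarrow> (nat, 'k::field) mpoly poly set" where
  "polys_over n = {p. \<forall>k. Polynomial.coeff p k \<in> carrier (poly_algebra n)}"

lemma polys_over_coeff: "p \<in> polys_over n \<Longrightarrow> Polynomial.coeff p k \<in> carrier (poly_algebra n)"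
  by (simp add: polys_over_def)

lemma polys_over_add: "\<lbrakk>p \<in> polys_over n; q \<in> polys_over n\<rbrakk> \<Longrightarrow> p + q \<in> polys_over n"
  by (simp add: polys_over_def poly_algebra_add)

lemma polys_over_diff: "\<lbrakk>p \<in> polys_over n; q \<in> polys_over n\<rbrakk> \<Longrightarrow> p - q \<in> polys_over n"
  by (simp add: polys_over_def poly_algebra_diff)

lemma polys_over_mult: "\<lbrakk>p \<in> polys_over n; q \<in> polys_over n\<rbrakk> \<Longrightarrow> p * q \<in> polys_over n"
  by (auto simp: polys_over_def coeff_mult intro!: poly_algebra_sum poly_algebra_mult)

lemma polys_over_smult: "\<lbrakk>c \<in> carrier (poly_algebra n); p \<in> polys_over n\<rbrakk> \<Longrightarrow> smult c p \<in> polys_over n"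
  by (simp add: polys_over_def poly_algebra_mult)

lemma polys_over_monom: "c \<in> carrier (poly_algebra n) \<Longrightarrow> Polynomial.monom c k \<in> polys_over n"
  by (simp add: polys_over_def poly_algebra_0)

lemma polys_over_0: "0 \<in> polys_over n"
  by (simp add: polys_over_def poly_algebra_0)

lemma polys_over_power: "p \<in> polys_over n \<Longrightarrow> p ^ k \<in> polys_over n"
proof (induction k)
  case 0
  show ?case using polys_over_monom[OF poly_algebra_1, where k = 0] by (simp add: monom_0 one_pCons)
qed (simp add: polys_over_mult)

lemma polys_over_sum: "(\<And>i. i \<in> I \<Longrightarrow> f i \<in> polys_over n) \<Longrightarrow> sum f I \<in> polys_over n"
  by (induction I rule: infinite_finite_induct) (auto simp: polys_over_0 polys_over_add)

lemma polys_over_eval_Var: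
  assumes "p \<in> polys_over n"
  shows "poly p (Var n) \<in> carrier (poly_algebra (Suc n))"
proof -
  have "Polynomial.coeff p k \<in> carrier (poly_algebra (Suc n))" for k
    using polys_over_coeff[OF assms] poly_algebra_mono[of n "Suc n"] by auto
  then show ?thesis unfolding poly_altdef by (intro poly_algebra_closed) auto
qed

lemma Var_power: "Var v ^ k = Poly_Mapping.single (Poly_Mapping.single v k) (1 :: 'k::field)"
proof (induction k)
  case (Suc k)
  have "Poly_Mapping.single v 1 + Poly_Mapping.single v k = Poly_Mapping.single v (Suc k)"
    by (simp flip: single_add)
  then show ?case unfolding power_Suc Suc.IH by (simp add: Var_def mult_single)
qed simp

text \<open>Sorting the terms by the exponent of the last variable makes degree and division in that
  variable available.\<close>

lemma poly_algebra_Suc_eq_poly_Var: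
  assumes "f \<in> carrier (poly_algebra (Suc n))"
  obtains p where "p \<in> polys_over n" "f = poly p (Var n)"
proof
  \<comment> \<open>\<open>r m\<close> is \<open>m\<close> without variable \<open>n\<close>; the
    lost exponent becomes the degree of \<open>t m\<close>.\<close>
  define r where "r m = m - Poly_Mapping.single n (Poly_Mapping.lookup m n)" for m :: "nat \<Rightarrow>\<^sub>0 nat"
  define t where "t m = Polynomial.monom (Poly_Mapping.single (r m) (Poly_Mapping.lookup f m))
    (Poly_Mapping.lookup m n)" for m
  let ?p = "\<Sum>m\<in>Poly_Mapping.keys f. t m"
  have r_keys: "Poly_Mapping.keys (r m) \<subseteq> {..<n}" if "m \<in> Poly_Mapping.keys f" for m
  proof
    fix v assume v: "v \<in> Poly_Mapping.keys (r m)"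
    then have "v \<noteq> n" "v \<in> Poly_Mapping.keys m"
      by (auto simp: r_def in_keys_iff lookup_minus lookup_single when_def split: if_splits)
    moreover have "v < Suc n" using assms that calculation(2) by (auto simp: carrier_poly_algebra)
    ultimately show "v \<in> {..<n}" by simp
  qed
  show "?p \<in> polys_over n"
    using r_keys unfolding t_def
    by (intro polys_over_sum polys_over_monom) (auto simp: carrier_poly_algebra)
  have "poly (t m) (Var n) = Poly_Mapping.single m (Poly_Mapping.lookup f m)" for m
  proof -
    have "r m + Poly_Mapping.single n (Poly_Mapping.lookup m n) = m"
      by (rule poly_mapping_eqI) (auto simp: r_def lookup_add lookup_minus lookup_single when_def)
    then show ?thesis by (simp add: t_def poly_monom Var_power mult_single)
  qed
  then have "poly ?p (Var n) = (\<Sum>m\<in>Poly_Mapping.keys f. Poly_Mapping.single m (Poly_Mapping.lookup f m))"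
    by (simp add: poly_sum)
  also have "\<dots> = f"
    by (rule poly_mapping_eqI) (auto simp: lookup_sum lookup_single when_def in_keys_iff)
  finally show "f = poly ?p (Var n)" by simp
qed

definition specialize :: "(nat \<Rightarrow> 'k) \<Rightarrow> (nat, 'k::field) mpoly poly \<Rightarrow> 'k poly" where
  "specialize x = map_poly (mpoly_eval x)"

lemma coeff_specialize: "Polynomial.coeff (specialize x p) k = mpoly_eval x (Polynomial.coeff p k)"
  by (simp add: specialize_def coeff_map_poly)

lemma specialize_add: "specialize x (p + q) = specialize x p + specialize x q"
  by (rule poly_eqI) (simp add: coeff_specialize mpoly_eval_simps)

lemma specialize_mult: "specialize x (p * q) = specialize x p * specialize x q"
  by (rule poly_eqI) (simp add: coeff_specialize coeff_mult mpoly_eval_simps)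

lemma specialize_smult: "specialize x (smult c p) = smult (mpoly_eval x c) (specialize x p)"
  by (rule poly_eqI) (simp add: coeff_specialize mpoly_eval_simps)

lemma specialize_power: "specialize x (p ^ k) = specialize x p ^ k"
proof (induction k)
  case 0
  show ?case by (rule poly_eqI) (simp add: coeff_specialize if_distrib)
qed (simp add: specialize_mult)

lemma degree_specialize_le: "Polynomial.degree (specialize x p) \<le> Polynomial.degree p"
  by (rule degree_le) (simp add: coeff_specialize coeff_eq_0)

text \<open>The coefficients do not see coordinate \<open>n\<close>. Zeros lying above
  \<open>x\<close> thus become roots of one-variable polynomials over the field.\<close>

lemma mpoly_eval_poly_Var:
  assumes "p \<in> polys_over n"
  shows "mpoly_eval (x(n := t)) (poly p (Var n)) = poly (specialize x p) t"
proof -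
  have "mpoly_eval (x(n := t)) (Polynomial.coeff p k) = mpoly_eval x (Polynomial.coeff p k)" for k
    by (rule mpoly_eval_cong[OF polys_over_coeff[OF assms]]) auto
  then have "mpoly_eval (x(n := t)) (poly p (Var n)) =
      (\<Sum>i\<le>Polynomial.degree p. Polynomial.coeff (specialize x p) i * t ^ i)"
    by (simp add: poly_altdef mpoly_eval_simps coeff_specialize)
  \<comment> \<open>Specializing may lower the degree; the surplus terms have coefficient 0.\<close>
  also have "\<dots> = poly (specialize x p) t"
    unfolding poly_altdef using degree_specialize_le[of x p]
    by (intro sum.mono_neutral_right) (auto simp: coeff_eq_0)
  finally show ?thesis .
qed

text \<open>Coefficients cannot be divided, so each round multiplies \<open>g\<close> by the leading
  coefficient of \<open>f\<close> before cancelling its top term; \<open>N\<close> counts the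
  rounds.\<close>

lemma pseudo_division_polys_over:
  assumes f: "f \<in> polys_over n" "Polynomial.degree f > 0" and g: "g \<in> polys_over n"
  shows "\<exists>N q r. q \<in> polys_over n \<and> r \<in> polys_over n \<and>
    Polynomial.degree r < Polynomial.degree f \<and> smult (lead_coeff f ^ N) g = q * f + r"
  using g
proof (induction "Polynomial.degree g" arbitrary: g rule: less_induct)
  case less
  show ?case
  proof (cases "Polynomial.degree g < Polynomial.degree f")
    case True
    then show ?thesis using less.prems
      by (intro exI[of _ 0] exI[of _ "0 :: (nat, 'a) mpoly poly"] exI[of _ g]) (simp add: polys_over_0)
  next
    case False
    let ?c = "lead_coeff f" and ?k = "Polynomial.degree g - Polynomial.degree f"
    let ?m = "Polynomial.monom (lead_coeff g) ?k"
    define g' where "g' = smult ?c g - ?m * f"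
    have c: "?c \<in> carrier (poly_algebra n)" by (rule polys_over_coeff[OF f(1)])
    have m: "?m \<in> polys_over n" by (rule polys_over_monom[OF polys_over_coeff[OF less.prems]])
    have "Polynomial.degree (?m * f) \<le> Polynomial.degree g"
      using degree_mult_le[of ?m f] degree_monom_le[of "lead_coeff g" ?k] False by linarith
    then have "Polynomial.degree g' \<le> Polynomial.degree g"
      unfolding g'_def by (intro degree_diff_le) (auto intro: order_trans[OF degree_smult_le])
    moreover have "Polynomial.coeff g' (Polynomial.degree g) = 0"
      using False by (simp add: g'_def coeff_monom_mult mult.commute[of "lead_coeff f"])
    \<comment> \<open>If \<open>g'\<close> is 0, its degree is 0, and the inequality is strict
      because \<open>f\<close> has positive degree.\<close>
    ultimately have deg: "Polynomial.degree g' < Polynomial.degree g"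
      using eq_zero_or_degree_less[of g'] f(2) False by force
    have "g' \<in> polys_over n"
      unfolding g'_def by (intro polys_over_diff polys_over_smult polys_over_mult c m f(1) less.prems)
    from less.hyps[OF deg this] obtain N q r where *: "q \<in> polys_over n" "r \<in> polys_over n"
      "Polynomial.degree r < Polynomial.degree f" "smult (?c ^ N) g' = q * f + r" by blast
    have "smult (?c ^ Suc N) g = smult (?c ^ N) g' + smult (?c ^ N) (?m * f)"
      unfolding g'_def smult_diff_right by (simp add: mult.commute)
    also have "\<dots> = (q + smult (?c ^ N) ?m) * f + r"
      unfolding *(4) by (simp add: algebra_simps)
    finally show ?thesis using *(1-3) c m
      by (intro exI[of _ "Suc N"] exI[of _ "q + smult (?c ^ N) ?m"] exI[of _ r])
        (auto intro: polys_over_add polys_over_smult poly_algebra_power)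
  qed
qed

text \<open>\<open>F\<close> splits into \<open>degree F\<close> linear factors, and each of them
  divides \<open>G\<close> because its root is a root of \<open>G\<close>.\<close>

lemma dvd_power_degree:
  fixes F G :: "'k::field poly"
  assumes closed: "\<And>q :: 'k poly. Polynomial.degree q > 0 \<Longrightarrow> \<exists>t. poly q t = 0"
    and "F \<noteq> 0" "\<And>t. poly F t = 0 \<Longrightarrow> poly G t = 0"
  shows "F dvd G ^ Polynomial.degree F"
  using assms(2,3)
proof (induction "Polynomial.degree F" arbitrary: F)
  case 0
  then have "F dvd 1" by (simp add: is_unit_iff_degree)
  then show ?case using dvd_trans one_dvd by blast
next
  case (Suc d)
  from closed[of F] Suc.hyps(2) obtain t where t: "poly F t = 0" by auto
  then obtain F' where F': "F = [:- t, 1:] * F'" by (auto simp: poly_eq_0_iff_dvd elim: dvdE)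
  then have "F' \<noteq> 0" using Suc.prems(1) by auto
  then have d: "d = Polynomial.degree F'"
    using Suc.hyps(2) degree_mult_eq[of "[:- t, 1:]" F'] F' by simp
  have "F' dvd G ^ d"
    unfolding d by (rule Suc.hyps(1)[OF d \<open>F' \<noteq> 0\<close>])
      (use Suc.prems(2) F' in auto)
  moreover have "[:- t, 1:] dvd G" using Suc.prems(2)[OF t] by (simp add: poly_eq_0_iff_dvd)
  ultimately have "[:- t, 1:] * F' dvd G * G ^ d" by (rule mult_dvd_mono[rotated])
  then show ?case using F' Suc.hyps(2) by (metis power_Suc)
qed

section \<open>Prime ideals and ideals avoiding the powers of a polynomial\<close>

lemma primeideal_poly_algebra_iff:
  "primeideal P (poly_algebra n) \<longleftrightarrow> ideal P (poly_algebra n) \<and> 1 \<notin> P \<and>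
     (\<forall>a\<in>carrier (poly_algebra n). \<forall>b\<in>carrier (poly_algebra n). a * b \<in> P \<longrightarrow> a \<in> P \<or> b \<in> P)"
  (is "_ \<longleftrightarrow> ?R")
proof
  assume P: "primeideal P (poly_algebra n)"
  then interpret primeideal P "poly_algebra n" .
  show ?R using is_ideal one_imp_carrier I_notcarr I_prime by auto
next
  assume R: ?R
  then interpret ideal P "poly_algebra n" by simp
  show "primeideal P (poly_algebra n)"
    by (rule primeidealI) (use R is_ideal cring_poly_algebra poly_algebra_1[of n] in auto)
qed

text \<open>The ideal generated by \<open>M\<close> and \<open>a\<close>, used to test the
  maximality of an ideal against a new element.\<close>

lemma ideal_poly_algebra_add_multiples:
  assumes M: "ideal M (poly_algebra n)" and a: "a \<in> carrier (poly_algebra n)"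
  defines "K \<equiv> {u + v * a | u v. u \<in> M \<and> v \<in> carrier (poly_algebra n)}"
  shows "ideal K (poly_algebra n)" "M \<subseteq> K" "a \<in> K"
proof -
  have M0: "0 \<in> M" and Madd: "\<And>p q. p \<in> M \<Longrightarrow> q \<in> M \<Longrightarrow> p + q \<in> M"
    and Mmult: "\<And>p q. p \<in> M \<Longrightarrow> q \<in> carrier (poly_algebra n) \<Longrightarrow> q * p \<in> M"
    and MA: "\<And>p. p \<in> M \<Longrightarrow> p \<in> carrier (poly_algebra n)"
    using M unfolding ideal_poly_algebra_iff by blast+
  have KI: "u + v * a \<in> K" if "u \<in> M" "v \<in> carrier (poly_algebra n)" for u v
    using that unfolding K_def by blast
  have KE: "\<exists>u\<in>M. \<exists>v\<in>carrier (poly_algebra n). p = u + v * a" if "p \<in> K" for p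
    using that unfolding K_def by blast
  show sub: "M \<subseteq> K" using KI[OF _ poly_algebra_0] by (simp add: subset_iff)
  show "a \<in> K" using KI[OF M0 poly_algebra_1] by simp
  show "ideal K (poly_algebra n)"
    unfolding ideal_poly_algebra_iff
  proof (intro conjI ballI)
    show "K \<subseteq> carrier (poly_algebra n)"
      using KE MA a by (metis poly_algebra_add poly_algebra_mult subsetI)
    show "0 \<in> K" using sub M0 by blast
    fix p assume "p \<in> K"
    then obtain u v where p: "u \<in> M" "v \<in> carrier (poly_algebra n)" "p = u + v * a"
      using KE by blast
    show "p + q \<in> K" if "q \<in> K" for q
    proof -
      obtain u' v' where q: "u' \<in> M" "v' \<in> carrier (poly_algebra n)" "q = u' + v' * a"
        using KE \<open>q \<in> K\<close> by blast
      have "p + q = (u + u') + (v + v') * a" by (simp add: p q algebra_simps)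
      then show ?thesis using KI[OF Madd poly_algebra_add, OF p(1) q(1) p(2) q(2)] by simp
    qed
    show "q * p \<in> K" if "q \<in> carrier (poly_algebra n)" for q
    proof -
      have "q * p = q * u + (q * v) * a" by (simp add: p algebra_simps)
      then show ?thesis using KI[OF Mmult poly_algebra_mult, OF p(1) that that p(2)] by simp
    qed
  qed
qed

text \<open>By Zorn's lemma there is a maximal ideal among those that contain \<open>J\<close> and
  no power of \<open>H\<close>. It is prime: adjoining either of two outside elements produces a
  power of \<open>H\<close>, and the product of these powers shows that the product of the elements
  is outside as well.\<close>

lemma primeideal_avoiding_powers:
  fixes J :: "(nat, 'k::field) mpoly set"
  assumes J: "ideal J (poly_algebra n)" and H: "H \<in> carrier (poly_algebra n)"
    and avoid: "\<And>m. H ^ m \<notin> J"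
  obtains P where "primeideal P (poly_algebra n)" "J \<subseteq> P" "H \<notin> P"
proof -
  define S where "S = {K. ideal K (poly_algebra n) \<and> J \<subseteq> K \<and> (\<forall>m. H ^ m \<notin> K)}"
  have "\<exists>M\<in>S. \<forall>K\<in>S. M \<subseteq> K \<longrightarrow> K = M"
  proof (rule subset_Zorn_nonempty)
    show "S \<noteq> {}" using J avoid by (auto simp: S_def)
    fix C assume C: "C \<noteq> {}" "subset.chain S C"
    then have CS: "C \<subseteq> S" and tot: "\<And>K L. K \<in> C \<Longrightarrow> L \<in> C \<Longrightarrow> K \<subseteq> L \<or> L \<subseteq> K"
      by (auto simp: subset_chain_def)
    obtain K0 where "K0 \<in> C" using C(1) by blast
    have id: "ideal K (poly_algebra n)" if "K \<in> C" for K using that CS by (auto simp: S_def)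
    have "ideal (\<Union>C) (poly_algebra n)"
      unfolding ideal_poly_algebra_iff
    proof (intro conjI ballI)
      show "\<Union>C \<subseteq> carrier (poly_algebra n)" using id unfolding ideal_poly_algebra_iff by blast
      show "0 \<in> \<Union>C" using id[OF \<open>K0 \<in> C\<close>] \<open>K0 \<in> C\<close> unfolding ideal_poly_algebra_iff by blast
      fix p assume "p \<in> \<Union>C"
      then obtain K where K: "K \<in> C" "p \<in> K" by blast
      show "p + q \<in> \<Union>C" if q: "q \<in> \<Union>C" for q
      proof -
        obtain L where L: "L \<in> C" "q \<in> L" using q by blast
        then have "\<exists>L\<in>C. p \<in> L \<and> q \<in> L" using K tot[of K L] by blast
        then show ?thesis using id unfolding ideal_poly_algebra_iff by blast
      qed
      show "q * p \<in> \<Union>C" if "q \<in> carrier (poly_algebra n)" for q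
        using that K id[OF K(1)] unfolding ideal_poly_algebra_iff by blast
    qed
    then show "\<Union>C \<in> S" using CS \<open>K0 \<in> C\<close> by (auto simp: S_def)
  qed
  then obtain M where M: "M \<in> S" and max: "\<And>K. K \<in> S \<Longrightarrow> M \<subseteq> K \<Longrightarrow> K = M" by blast
  have idM: "ideal M (poly_algebra n)" and JM: "J \<subseteq> M" and HM: "\<And>m. H ^ m \<notin> M"
    using M by (auto simp: S_def)
  have power_in: "\<exists>m. \<exists>u\<in>M. \<exists>v\<in>carrier (poly_algebra n). H ^ m = u + v * a"
    if a: "a \<in> carrier (poly_algebra n)" "a \<notin> M" for a
  proof -
    let ?K = "{u + v * a | u v. u \<in> M \<and> v \<in> carrier (poly_algebra n)}"
    note K = ideal_poly_algebra_add_multiples[OF idM a(1)]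
    have "?K \<notin> S" using max[of ?K] K(2,3) a(2) by blast
    then have "\<exists>m. H ^ m \<in> ?K" using K(1,2) JM by (auto simp: S_def)
    then show ?thesis by blast
  qed
  have "a \<in> M \<or> b \<in> M"
    if a: "a \<in> carrier (poly_algebra n)" and b: "b \<in> carrier (poly_algebra n)" and ab: "a * b \<in> M" for a b
  proof (rule ccontr)
    assume "\<not> ?thesis"
    then obtain m u v k u' v' where
      1: "u \<in> M" "v \<in> carrier (poly_algebra n)" "H ^ m = u + v * a" and
      2: "u' \<in> M" "v' \<in> carrier (poly_algebra n)" "H ^ k = u' + v' * b"
      using power_in[OF a] power_in[OF b] by blast
    \<comment> \<open>Grouped so that each summand is a multiple of \<open>u\<close>, of
      \<open>u'\<close> or of \<open>a * b\<close>, all in \<open>M\<close>.\<close>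
    have "H ^ (m + k) = (u' + v' * b) * u + (v * a) * u' + (v * v') * (a * b)"
      by (simp add: power_add 1 2 algebra_simps)
    moreover have "(u' + v' * b) * u \<in> M"
      using idM 1(1) poly_algebra_power[OF H, of k] 2(3) unfolding ideal_poly_algebra_iff by simp
    moreover have "(v * a) * u' \<in> M"
      using idM 2(1) poly_algebra_mult[OF 1(2) a] unfolding ideal_poly_algebra_iff by blast
    moreover have "(v * v') * (a * b) \<in> M"
      using idM ab poly_algebra_mult[OF 1(2) 2(2)] unfolding ideal_poly_algebra_iff by blast
    ultimately have "H ^ (m + k) \<in> M" using idM unfolding ideal_poly_algebra_iff by simp
    then show False using HM by blast
  qed
  moreover have "1 \<notin> M" using HM[of 0] by simp
  ultimately have "primeideal M (poly_algebra n)"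
    using idM unfolding primeideal_poly_algebra_iff by blast
  then show thesis using that JM HM[of 1] by simp
qed

text \<open>Induction on the number of variables.  In the algebraic case let \<open>f \<in> P\<close>, as a polynomial in the
  last variable, have minimal degree among those with a coefficient outside \<open>P' = P \<inter> A\<^sub>n\<close>.  At a zero
  of \<open>P'\<close> where the leading coefficient of \<open>f\<close> does not vanish, pseudo-division shows that \<open>P\<close>
  vanishes at all roots of the specialization of \<open>f\<close>.  If \<open>H\<close> vanished there too, \<open>f\<close> would divide the
  pseudo-remainder of \<open>H ^ degree f\<close>, one of whose coefficients can be kept nonzero.\<close>

lemma primeideal_has_point:
  fixes P :: "(nat, 'k::field) mpoly set"
  assumes closed: "\<And>q :: 'k poly. Polynomial.degree q > 0 \<Longrightarrow> \<exists>t. poly q t = 0"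
    and "primeideal P (poly_algebra n)" "H \<in> carrier (poly_algebra n)" "H \<notin> P"
  shows "\<exists>x. (\<forall>f\<in>P. mpoly_eval x f = 0) \<and> mpoly_eval x H \<noteq> 0"
  using assms(2-)
proof (induction n arbitrary: P H)
  case 0
  have const: "\<exists>c. f = Const c" if "f \<in> carrier (poly_algebra 0)" for f :: "(nat, 'k) mpoly"
  proof -
    have "Poly_Mapping.keys f \<subseteq> {0}" using that by (auto simp: carrier_poly_algebra)
    then have "f = Const (Poly_Mapping.lookup f 0)"
      by (intro poly_mapping_eqI) (auto simp: Const_def lookup_single when_def in_keys_iff)
    then show ?thesis ..
  qed
  have "f = 0" if f: "f \<in> P" for f
  proof -
    have id: "ideal P (poly_algebra 0)" and "1 \<notin> P"
      using 0(1) by (auto simp: primeideal_poly_algebra_iff)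
    then obtain c where c: "f = Const c" using const[of f] f unfolding ideal_poly_algebra_iff by blast
    \<comment> \<open>For nonzero \<open>c\<close> this element would be 1.\<close>
    have "Const (1 / c) * f \<in> P"
      using id f poly_algebra_Const unfolding ideal_poly_algebra_iff by blast
    then have "c = 0" using \<open>1 \<notin> P\<close> by (auto simp: c Const_def mult_single split: if_splits)
    then show ?thesis by (simp add: c Const_def)
  qed
  moreover have "mpoly_eval x H \<noteq> 0" for x
    using 0 const[of H] by (auto simp: Const_def primeideal_poly_algebra_iff ideal_poly_algebra_iff mpoly_eval_single)
  ultimately show ?case using mpoly_eval_0 by metis
next
  case (Suc n)
  let ?A = "carrier (poly_algebra n) :: (nat, 'k) mpoly set"
  let ?A' = "carrier (poly_algebra (Suc n)) :: (nat, 'k) mpoly set"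
  let ?ev = "\<lambda>p. poly p (Var n) :: (nat, 'k) mpoly"
  have up: "f \<in> ?A \<Longrightarrow> f \<in> ?A'" for f
    using poly_algebra_mono[of n "Suc n"] by auto
  have idP: "ideal P (poly_algebra (Suc n))" and one: "1 \<notin> P"
    and prime: "\<And>a b. a \<in> ?A' \<Longrightarrow> b \<in> ?A' \<Longrightarrow> a * b \<in> P \<Longrightarrow> a \<in> P \<or> b \<in> P"
    using Suc.prems(1) unfolding primeideal_poly_algebra_iff by blast+
  have PA: "P \<subseteq> ?A'" and P0: "0 \<in> P" and Padd: "\<And>a b. a \<in> P \<Longrightarrow> b \<in> P \<Longrightarrow> a + b \<in> P"
    and Pmult: "\<And>a b. a \<in> P \<Longrightarrow> b \<in> ?A' \<Longrightarrow> b * a \<in> P"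
    using idP unfolding ideal_poly_algebra_iff by blast+
  have prime_power: "a \<in> P" if "a ^ k \<in> P" "a \<in> ?A'" for a k
    using that
  proof (induction k)
    case (Suc k)
    then show ?case using prime[of a "a ^ k"] poly_algebra_power by auto
  qed (use one in simp)
  define P' where "P' = P \<inter> ?A"
  have primeP': "primeideal P' (poly_algebra n)"
    unfolding primeideal_poly_algebra_iff ideal_poly_algebra_iff P'_def
    using P0 Padd Pmult one prime up
    by (auto intro: poly_algebra_closed)
  \<comment> \<open>\<open>small p\<close> means that \<open>p\<close> is 0 modulo
    \<open>P'\<close>; specialization at a zero of \<open>P'\<close> kills it.\<close>
  define small where "small p \<longleftrightarrow> (\<forall>k. Polynomial.coeff p k \<in> P')" for p
  have small_ev: "?ev p \<in> P" if "small p" for p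
    unfolding poly_altdef
  proof (rule ideal_poly_algebra_sum[OF idP])
    fix i
    have "Var n ^ i * Polynomial.coeff p i \<in> P"
      using that by (intro Pmult poly_algebra_closed) (auto simp: small_def P'_def)
    then show "Polynomial.coeff p i * Var n ^ i \<in> P" by (simp add: mult.commute)
  qed
  have small_specialize: "specialize x p = 0" if "small p" "\<forall>f\<in>P'. mpoly_eval x f = 0" for x p
    using that by (intro poly_eqI) (simp add: coeff_specialize small_def)
  obtain h where h: "h \<in> polys_over n" "H = ?ev h"
    using poly_algebra_Suc_eq_poly_Var[OF Suc.prems(2)] .
  show ?case
  proof (cases "\<forall>p\<in>polys_over n. ?ev p \<in> P \<longrightarrow> small p")
    \<comment> \<open>The last variable is transcendental modulo \<open>P'\<close>. Elements of
      \<open>P\<close> specialize to 0 above every zero of \<open>P'\<close>, so the last coordinate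
      is free and only has to avoid the roots of \<open>?h\<close>.\<close>
    case True
    have "\<not> small h" using small_ev[of h] h(2) Suc.prems(3) by blast
    then obtain k where k: "Polynomial.coeff h k \<notin> P'" by (auto simp: small_def)
    obtain x where x: "\<forall>f\<in>P'. mpoly_eval x f = 0" "mpoly_eval x (Polynomial.coeff h k) \<noteq> 0"
      using Suc.IH[OF primeP' polys_over_coeff[OF h(1)] k] by blast
    let ?h = "specialize x h"
    have h0: "?h \<noteq> 0" using x(2) by (auto simp flip: coeff_specialize)
    have "\<exists>t. poly ?h t \<noteq> 0"
    proof (cases "Polynomial.degree ?h = 0")
      case True
      then obtain c where "?h = [:c:]" by (rule degree_eq_zeroE)
      then show ?thesis using h0 by auto
    next
      case False
      \<comment> \<open>A root of \<open>?h - 1\<close> is a point where \<open>?h\<close> takes the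
        value 1.\<close>
      then have "Polynomial.degree (?h - 1) > 0"
        using degree_add_eq_left[of "- 1" ?h] by simp
      then obtain t where "poly (?h - 1) t = 0" using closed by blast
      then show ?thesis by (intro exI[of _ t]) simp
    qed
    then obtain t where t: "poly ?h t \<noteq> 0" by blast
    show ?thesis
    proof (intro exI[of _ "x(n := t)"] conjI ballI)
      fix f assume f: "f \<in> P"
      then obtain p where p: "p \<in> polys_over n" "f = ?ev p"
        using poly_algebra_Suc_eq_poly_Var[of f n] PA by blast
      then have "specialize x p = 0" using True f x(1) small_specialize by blast
      then show "mpoly_eval (x(n := t)) f = 0" by (simp only: p(2) mpoly_eval_poly_Var[OF p(1)] poly_0)
    next
      show "mpoly_eval (x(n := t)) H \<noteq> 0" unfolding h(2) mpoly_eval_poly_Var[OF h(1)] by (rule t)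
    qed
  next
    case False
    define bad where "bad p \<longleftrightarrow> p \<in> polys_over n \<and> ?ev p \<in> P \<and> \<not> small p" for p
    obtain f where f: "bad f" and min: "\<And>p. bad p \<Longrightarrow> Polynomial.degree f \<le> Polynomial.degree p"
      using False ex_has_least_nat[of bad _ Polynomial.degree] unfolding bad_def by blast
    let ?c = "lead_coeff f" and ?d = "Polynomial.degree f"
    have fA: "f \<in> polys_over n" and evf: "?ev f \<in> P" and nsf: "\<not> small f"
      using f by (auto simp: bad_def)
    have cA: "?c \<in> ?A" by (rule polys_over_coeff[OF fA])
    \<comment> \<open>Otherwise \<open>f\<close> without its leading term would still be bad;
      minimality of the degree would force this difference to be 0, which is small.\<close>
    have c: "?c \<notin> P'"
    proof
      assume c: "?c \<in> P'"
      let ?m = "Polynomial.monom ?c ?d"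
      have sm: "small ?m" using c primeP'
        by (auto simp: small_def primeideal_poly_algebra_iff ideal_poly_algebra_iff)
      have "small f" if "small (f - ?m)"
      proof -
        have "Polynomial.coeff (f - ?m) k + Polynomial.coeff ?m k \<in> P'" for k
          using primeP' that sm unfolding small_def primeideal_poly_algebra_iff ideal_poly_algebra_iff
          by blast
        then show ?thesis by (simp add: small_def)
      qed
      then have ns: "\<not> small (f - ?m)" using nsf by blast
      have "?ev (f - ?m) \<in> P"
        using ideal_poly_algebra_diff[OF idP evf small_ev[OF sm]] by simp
      moreover have "f - ?m \<in> polys_over n"
        by (intro polys_over_diff polys_over_monom fA cA)
      ultimately have "?d \<le> Polynomial.degree (f - ?m)" using ns by (intro min) (auto simp: bad_def)
      moreover have "Polynomial.degree (f - ?m) \<le> ?d"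
        by (intro degree_diff_le) (auto simp: degree_monom_le)
      moreover have "Polynomial.coeff (f - ?m) ?d = 0" by simp
      ultimately have "f - ?m = 0" by (metis leading_coeff_0_iff order_antisym)
      then have "small (f - ?m)" using primeP'
        by (simp add: small_def primeideal_poly_algebra_iff ideal_poly_algebra_iff)
      then show False using ns by blast
    qed
    \<comment> \<open>In degree 0 the value \<open>?ev f\<close> is the leading coefficient itself,
      which would then lie in \<open>P'\<close>.\<close>
    have d: "?d > 0"
    proof (rule ccontr)
      assume "\<not> ?thesis"
      then obtain b where "f = [:b:]" using degree_eq_zeroE[of f] by blast
      then show False using evf c cA by (auto simp: P'_def)
    qed
    have cP: "?c ^ N \<notin> P" for N using c cA prime_power up by (auto simp: P'_def)
    have evA: "?ev p \<in> ?A'" if "p \<in> polys_over n" for p by (rule polys_over_eval_Var[OF that])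
    \<comment> \<open>Modulo \<open>P\<close> the multiple of \<open>f\<close> disappears, so the
      scaled \<open>g\<close> and its pseudo-remainder lie in \<open>P\<close> together.\<close>
    have reduce: "?c ^ N * ?ev g \<in> P \<longleftrightarrow> ?ev r \<in> P"
      if "q \<in> polys_over n" "smult (?c ^ N) g = q * f + r" for N g q r
    proof -
      have eq: "?c ^ N * ?ev g = ?ev q * ?ev f + ?ev r"
        using arg_cong[OF that(2), of ?ev] by simp
      have "?ev q * ?ev f \<in> P" by (rule Pmult[OF evf evA[OF that(1)]])
      then show ?thesis unfolding eq
        using Padd ideal_poly_algebra_diff[OF idP, of "?ev q * ?ev f + ?ev r" "?ev q * ?ev f"] by auto
    qed
    obtain N q r where qr: "q \<in> polys_over n" "r \<in> polys_over n" "Polynomial.degree r < ?d"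
      "smult (?c ^ N) (h ^ ?d) = q * f + r"
      using pseudo_division_polys_over[OF fA d polys_over_power[OF h(1)]] by blast
    have "?c ^ N * H ^ ?d \<notin> P"
    proof
      assume "?c ^ N * H ^ ?d \<in> P"
      then have "H ^ ?d \<in> P"
        using prime[of "?c ^ N" "H ^ ?d"] cP poly_algebra_power[OF up[OF cA]]
          poly_algebra_power[OF Suc.prems(2)] by blast
      then show False using prime_power Suc.prems(2,3) by blast
    qed
    then have "?ev r \<notin> P" using reduce[OF qr(1,4)] by (simp add: h(2))
    then obtain j where j: "Polynomial.coeff r j \<notin> P'" using small_ev[of r] by (auto simp: small_def)
    let ?a = "?c * Polynomial.coeff r j"
    have jA: "Polynomial.coeff r j \<in> ?A" by (rule polys_over_coeff[OF qr(2)])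
    \<comment> \<open>With the product, one application of the induction hypothesis gives a point
      where neither the leading coefficient of \<open>f\<close> nor the chosen coefficient of
      \<open>r\<close> vanishes.\<close>
    have "?a \<notin> P'" using primeP' c j cA jA unfolding primeideal_poly_algebra_iff by blast
    then obtain x where x: "\<forall>f\<in>P'. mpoly_eval x f = 0" "mpoly_eval x ?a \<noteq> 0"
      using Suc.IH[OF primeP' poly_algebra_mult[OF cA jA]] by blast
    let ?F = "specialize x f" and ?R = "specialize x r" and ?h = "specialize x h"
    have cx: "mpoly_eval x ?c \<noteq> 0" and jx: "mpoly_eval x (Polynomial.coeff r j) \<noteq> 0"
      using x(2) by (auto simp: mpoly_eval_mult)
    have "Polynomial.coeff ?F ?d \<noteq> 0" using cx by (simp add: coeff_specialize)
    then have degF: "Polynomial.degree ?F = ?d" and F0: "?F \<noteq> 0"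
      using le_degree[of ?F ?d] degree_specialize_le[of x f] by (auto simp: order_antisym)
    have R0: "?R \<noteq> 0" using jx by (auto simp flip: coeff_specialize)
    have "\<exists>t. poly ?F t = 0 \<and> poly ?h t \<noteq> 0"
    proof (rule ccontr)
      assume "\<not> ?thesis"
      then have "?F dvd ?h ^ ?d" using dvd_power_degree[OF closed F0, of ?h] degF by auto
      moreover have "smult (mpoly_eval x ?c ^ N) (?h ^ ?d) = specialize x q * ?F + ?R"
        using arg_cong[OF qr(4), of "specialize x"]
        by (simp add: specialize_add specialize_mult specialize_smult specialize_power mpoly_eval_simps)
      ultimately have "?F dvd specialize x q * ?F + ?R" by (metis dvd_smult)
      then have "?F dvd ?R" by (simp add: dvd_add_right_iff)
      then have "?d \<le> Polynomial.degree ?R" using dvd_imp_degree_le[OF _ R0, of ?F] degF by simp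
      then show False using qr(3) degree_specialize_le[of x r] by linarith
    qed
    then obtain t where t: "poly ?F t = 0" "poly ?h t \<noteq> 0" by blast
    show ?thesis
    proof (intro exI[of _ "x(n := t)"] conjI ballI)
      fix g assume g: "g \<in> P"
      then obtain p where p: "p \<in> polys_over n" "g = ?ev p"
        using poly_algebra_Suc_eq_poly_Var[of g n] PA by blast
      obtain N q r where qr: "q \<in> polys_over n" "r \<in> polys_over n" "Polynomial.degree r < ?d"
        "smult (?c ^ N) p = q * f + r"
        using pseudo_division_polys_over[OF fA d p(1)] by blast
      have "?c ^ N * ?ev p \<in> P"
        using Pmult[OF g poly_algebra_power[OF up[OF cA]]] by (simp add: p(2))
      then have "?ev r \<in> P" using reduce[OF qr(1,4)] by blast
      \<comment> \<open>Its degree is below that of \<open>f\<close>, so by minimality it cannot be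
        bad.\<close>
      then have "small r" using min[of r] qr(2,3) by (auto simp: bad_def)
      then have "specialize x r = 0" using small_specialize x(1) by blast
      then have "mpoly_eval x ?c ^ N * poly (specialize x p) t = 0"
        using arg_cong[OF qr(4), of "\<lambda>p. poly (specialize x p) t"] t(1)
        by (simp add: specialize_add specialize_mult specialize_smult mpoly_eval_simps)
      then show "mpoly_eval (x(n := t)) g = 0"
        using cx by (simp only: p(2) mpoly_eval_poly_Var[OF p(1)]) simp
    next
      show "mpoly_eval (x(n := t)) H \<noteq> 0" unfolding h(2) mpoly_eval_poly_Var[OF h(1)] by (rule t(2))
    qed
  qed
qed

text \<open>If no power of \<open>H\<close> were in \<open>J\<close>, some prime ideal above
  \<open>J\<close> would avoid \<open>H\<close>, and it has a zero at which \<open>H\<close> does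
  not vanish.\<close>

theorem nullstellensatz:
  fixes J :: "(nat, 'k::field) mpoly set"
  assumes closed: "\<And>q :: 'k poly. Polynomial.degree q > 0 \<Longrightarrow> \<exists>t. poly q t = 0"
    and J: "ideal J (poly_algebra n)" and H: "H \<in> carrier (poly_algebra n)"
    and sub: "zero_set n J \<subseteq> zero_set n {H}"
  shows "\<exists>m. H ^ m \<in> J"
proof (rule ccontr)
  assume "\<not> ?thesis"
  then obtain P where P: "primeideal P (poly_algebra n)" "J \<subseteq> P" "H \<notin> P"
    using primeideal_avoiding_powers[OF J H] by blast
  obtain x where x: "\<And>f. f \<in> P \<Longrightarrow> mpoly_eval x f = 0" "mpoly_eval x H \<noteq> 0"
    using primeideal_has_point[OF closed P(1) H P(3)] by blast
  let ?x = "restrict x {..<n}"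
  have eq: "mpoly_eval ?x f = mpoly_eval x f" if "f \<in> carrier (poly_algebra n)" for f
    by (rule mpoly_eval_cong[OF that]) simp
  have "J \<subseteq> carrier (poly_algebra n)" using J by (simp add: ideal_poly_algebra_iff)
  then have "?x \<in> zero_set n J" using eq x(1) P(2) by (auto simp: zero_set_def affine_space_def subset_iff)
  then show False using sub x(2) eq[OF H] by (auto simp: zero_set_def)
qed

section \<open>Algebras of functions and the coordinate algebra\<close>

lemma homogenize_1: "homogenize (1 :: ('v, 'k::field) mpoly) = 1"
  by (simp add: homogenize_def total_deg_def mon_deg_def Const_1)

text \<open>With y the value at \<open>None\<close> and d the total degree, a monomial of degree e
  gets the factor y^(d - e), which is y^d with each of its e variable factors divided by y.\<close>

lemma mpoly_eval_homogenize:
  fixes D :: "('v, 'k::field) mpoly"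
  assumes y: "R None \<noteq> 0"
  shows "mpoly_eval R (homogenize D) =
    R None ^ total_deg D * mpoly_eval (\<lambda>v. R (Some v) / R None) D"
proof -
  let ?y = "R None"
  have "Poly_Mapping.lookup D m * (\<Prod>v\<in>Poly_Mapping.keys m. R (Some v) ^ Poly_Mapping.lookup m v) * ?y ^ (total_deg D - mon_deg m) =
      ?y ^ total_deg D * (Poly_Mapping.lookup D m * (\<Prod>v\<in>Poly_Mapping.keys m. (R (Some v) / ?y) ^ Poly_Mapping.lookup m v))"
    if "m \<in> Poly_Mapping.keys D" for m
  proof -
    \<comment> \<open>This makes the truncated difference in \<open>homogenize\<close>
      exact.\<close>
    have "mon_deg m \<le> total_deg D" unfolding total_deg_def using that by (intro Max_ge) auto
    then have "?y ^ total_deg D = ?y ^ (total_deg D - mon_deg m) * ?y ^ mon_deg m"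
      by (simp flip: power_add)
    moreover have "(\<Prod>v\<in>Poly_Mapping.keys m. (R (Some v) / ?y) ^ Poly_Mapping.lookup m v) =
        (\<Prod>v\<in>Poly_Mapping.keys m. R (Some v) ^ Poly_Mapping.lookup m v) / ?y ^ mon_deg m"
      by (simp add: power_divide prod_dividef mon_deg_def power_sum)
    ultimately show ?thesis using y by simp
  qed
  then show ?thesis
    unfolding homogenize_def mpoly_eval_simps mpoly_eval_Const mpoly_eval_Var
    unfolding mpoly_eval_def sum_distrib_left by (rule sum.cong[OF refl])
qed

text \<open>Operations act pointwise and points separate elements (\<open>fa_eqI\<close>). The
  coordinate algebra, its localization and the algebras of sections are all shown to be of this
  kind, so their ring and algebra axioms come from those of the field.\<close>

locale function_algebra =
  fixes A :: "('k::field, 'a, 'm) module_scheme" (structure)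
    and S :: "'s set" and e :: "'s \<Rightarrow> 'a \<Rightarrow> 'k"
  assumes fa_closed: "\<zero> \<in> carrier A" "\<one> \<in> carrier A"
      "\<And>x y. \<lbrakk>x \<in> carrier A; y \<in> carrier A\<rbrakk> \<Longrightarrow> x \<oplus> y \<in> carrier A"
      "\<And>x y. \<lbrakk>x \<in> carrier A; y \<in> carrier A\<rbrakk> \<Longrightarrow> x \<otimes> y \<in> carrier A"
      "\<And>c x. x \<in> carrier A \<Longrightarrow> c \<odot> x \<in> carrier A"
    and fa_eval: "\<And>s. s \<in> S \<Longrightarrow> e s \<zero> = 0" "\<And>s. s \<in> S \<Longrightarrow> e s \<one> = 1"
      "\<And>s x y. \<lbrakk>s \<in> S; x \<in> carrier A; y \<in> carrier A\<rbrakk> \<Longrightarrow> e s (x \<oplus> y) = e s x + e s y"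
      "\<And>s x y. \<lbrakk>s \<in> S; x \<in> carrier A; y \<in> carrier A\<rbrakk> \<Longrightarrow> e s (x \<otimes> y) = e s x * e s y"
      "\<And>s c x. \<lbrakk>s \<in> S; x \<in> carrier A\<rbrakk> \<Longrightarrow> e s (c \<odot> x) = c * e s x"
    and fa_eqI: "\<And>x y. \<lbrakk>x \<in> carrier A; y \<in> carrier A; \<And>s. s \<in> S \<Longrightarrow> e s x = e s y\<rbrakk> \<Longrightarrow> x = y"
begin

lemma fa_cring: "cring A"
proof (rule cringI)
  show "abelian_group A"
  proof (rule abelian_groupI)
    fix x assume "x \<in> carrier A"
    then show "\<exists>y\<in>carrier A. y \<oplus> x = \<zero>"
      by (intro bexI[of _ "(- 1) \<odot> x"] fa_eqI) (simp_all add: fa_closed fa_eval)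
  qed (auto intro!: fa_eqI simp: fa_closed fa_eval algebra_simps)
  show "comm_monoid A"
    by (rule comm_monoidI) (auto intro!: fa_eqI simp: fa_closed fa_eval algebra_simps)
qed (auto intro!: fa_eqI simp: fa_closed fa_eval algebra_simps)

lemma fa_kalgebra: "kalgebra A"
  unfolding kalgebra_def
  by (intro algebraI cring_from_type_algebra fa_cring)
    (auto intro!: fa_eqI simp: fa_closed fa_eval algebra_simps ring_of_type_algebra_def)

lemma fa_minus:
  assumes "s \<in> S" "x \<in> carrier A" "y \<in> carrier A"
  shows "e s (x \<ominus> y) = e s x - e s y"
proof -
  interpret cring A by (rule fa_cring)
  have "e s (\<ominus> y) + e s y = 0"
    using fa_eval(3)[of s "\<ominus> y" y] assms by (simp add: l_neg fa_eval)
  then have "e s (\<ominus> y) = - e s y" by (simp add: eq_neg_iff_add_eq_0)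
  then show ?thesis using fa_eval(3)[of s x "\<ominus> y"] assms by (simp add: a_minus_def)
qed

lemma fa_pow:
  assumes "x \<in> carrier A"
  shows "x [^] (k :: nat) \<in> carrier A" "s \<in> S \<Longrightarrow> e s (x [^] k) = e s x ^ k"
proof -
  interpret cring A by (rule fa_cring)
  show closed: "x [^] k \<in> carrier A" for k :: nat using assms by simp
  show "e s (x [^] k) = e s x ^ k" if "s \<in> S"
    using that assms closed by (induction k) (simp_all add: fa_eval)
qed

lemma fa_finprod:
  assumes "f \<in> I \<rightarrow> carrier A" "s \<in> S"
  shows "e s (\<Otimes>i\<in>I. f i) = (\<Prod>i\<in>I. e s (f i))"
proof -
  interpret cring A by (rule fa_cring)
  show ?thesis using assms
    by (induction I rule: infinite_finite_induct) (simp_all add: fa_eval Pi_iff)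
qed

lemma fa_finsum:
  assumes "f \<in> I \<rightarrow> carrier A" "s \<in> S"
  shows "e s (\<Oplus>i\<in>I. f i) = (\<Sum>i\<in>I. e s (f i))"
proof -
  interpret cring A by (rule fa_cring)
  show ?thesis using assms
  proof (induction I rule: infinite_finite_induct)
    case (infinite I)
    then show ?case by (simp add: finsum_infinite fa_eval)
  qed (simp_all add: fa_eval Pi_iff)
qed

text \<open>Evaluation at a point is a morphism to the field, so it commutes with polynomial
  expressions; statements about \<open>D\<close> over the field thereby reach the algebra.\<close>

lemma fa_alg_eval:
  fixes b :: "'v \<Rightarrow> 'a"
  assumes b: "b \<in> UNIV \<rightarrow> carrier A"
  shows "alg_eval A b p \<in> carrier A" "s \<in> S \<Longrightarrow> e s (alg_eval A b p) = mpoly_eval (\<lambda>v. e s (b v)) p"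
proof -
  interpret cring A by (rule fa_cring)
  have bc: "b v \<in> carrier A" for v using b by auto
  have monomial: "(\<Otimes>v\<in>Poly_Mapping.keys m. b v [^] Poly_Mapping.lookup m v) \<in> carrier A" for m :: "'v \<Rightarrow>\<^sub>0 nat"
    using bc fa_pow(1) by (intro finprod_closed) auto
  show "alg_eval A b p \<in> carrier A"
    unfolding alg_eval_def by (intro finsum_closed) (auto intro: fa_closed monomial)
  show "e s (alg_eval A b p) = mpoly_eval (\<lambda>v. e s (b v)) p" if s: "s \<in> S"
  proof -
    have "e s (\<Otimes>v\<in>Poly_Mapping.keys m. b v [^] Poly_Mapping.lookup m v) =
        (\<Prod>v\<in>Poly_Mapping.keys m. e s (b v) ^ Poly_Mapping.lookup m v)" for m :: "'v \<Rightarrow>\<^sub>0 nat"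
      using fa_finprod[of "\<lambda>v. b v [^] Poly_Mapping.lookup m v" "Poly_Mapping.keys m" s]
      by (simp add: bc fa_pow s)
    then show ?thesis
      unfolding alg_eval_def mpoly_eval_def
      by (subst fa_finsum[OF _ s]) (auto simp: fa_eval fa_closed monomial s)
  qed
qed

end

section \<open>The coordinate algebra\<close>

lemma ideal_vanishing_ideal: "ideal (vanishing_ideal n V) (poly_algebra n)"
  unfolding ideal_poly_algebra_iff vanishing_ideal_def
  by (auto simp: poly_algebra_closed mpoly_eval_simps)

abbreviation coord_class :: "nat \<Rightarrow> (nat \<Rightarrow> 'k::field) set \<Rightarrow> (nat, 'k) mpoly \<Rightarrow> (nat, 'k) mpoly set" where
  "coord_class n V p \<equiv> vanishing_ideal n V +>\<^bsub>poly_algebra n\<^esub> p"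

text \<open>Congruence modulo the vanishing ideal is agreement on \<open>V\<close>. This makes
  \<open>coord_eval\<close> well defined and lets the points of \<open>V\<close> separate
  cosets.\<close>

lemma coord_class_eq:
  assumes "p \<in> carrier (poly_algebra n)"
  shows "coord_class n V p = {q \<in> carrier (poly_algebra n). \<forall>P\<in>V. mpoly_eval P q = mpoly_eval P p}"
proof (intro equalityI subsetI)
  fix q assume "q \<in> coord_class n V p"
  then obtain i where "i \<in> vanishing_ideal n V" "q = i + p"
    by (auto simp: a_r_coset_def')
  then show "q \<in> {q \<in> carrier (poly_algebra n). \<forall>P\<in>V. mpoly_eval P q = mpoly_eval P p}"
    using assms by (auto simp: vanishing_ideal_def poly_algebra_add mpoly_eval_simps)
next
  fix q assume "q \<in> {q \<in> carrier (poly_algebra n). \<forall>P\<in>V. mpoly_eval P q = mpoly_eval P p}"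
  then have "q - p \<in> vanishing_ideal n V" "q = (q - p) + p"
    using assms by (auto simp: vanishing_ideal_def poly_algebra_diff mpoly_eval_simps)
  then show "q \<in> coord_class n V p" unfolding a_r_coset_def' by (auto intro!: bexI[of _ "q - p"])
qed

lemma coord_class_0: "coord_class n V 0 = vanishing_ideal n V"
  by (simp add: coord_class_eq poly_algebra_0) (simp add: vanishing_ideal_def)

lemma coord_eval_class:
  assumes "p \<in> carrier (poly_algebra n)" "P \<in> V"
  shows "coord_eval P (coord_class n V p) = mpoly_eval P p"
proof -
  have "mpoly_eval P ` coord_class n V p = {mpoly_eval P p}"
    unfolding coord_class_eq[OF assms(1)] using assms by auto
  then show ?thesis by (simp add: coord_eval_def)
qed

lemma coord_algebra_carrier:
  "carrier (coord_algebra n V) = coord_class n V ` carrier (poly_algebra n)"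
  by (auto simp: coord_algebra_def quot_algebra_def ring.defs module.defs FactRing_def
      A_RCOSETS_def' a_r_coset_def')

lemma coord_algebra_class_closed:
  "p \<in> carrier (poly_algebra n) \<Longrightarrow> coord_class n V p \<in> carrier (coord_algebra n V)"
  by (simp add: coord_algebra_carrier)

lemma coord_algebra_cases:
  assumes "g \<in> carrier (coord_algebra n V)"
  obtains p where "p \<in> carrier (poly_algebra n)" "g = coord_class n V p"
    "\<And>P. P \<in> V \<Longrightarrow> coord_eval P g = mpoly_eval P p"
  using assms coord_eval_class unfolding coord_algebra_carrier by blast

lemma coord_algebra_ops:
  fixes n :: nat and V :: "(nat \<Rightarrow> 'k::field) set"
  defines "A \<equiv> coord_algebra n V"
  shows "\<one>\<^bsub>A\<^esub> = coord_class n V 1" "\<zero>\<^bsub>A\<^esub> = coord_class n V 0"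
    and "\<lbrakk>p \<in> carrier (poly_algebra n); q \<in> carrier (poly_algebra n)\<rbrakk> \<Longrightarrow>
      coord_class n V p \<oplus>\<^bsub>A\<^esub> coord_class n V q = coord_class n V (p + q)"
    and "\<lbrakk>p \<in> carrier (poly_algebra n); q \<in> carrier (poly_algebra n)\<rbrakk> \<Longrightarrow>
      coord_class n V p \<otimes>\<^bsub>A\<^esub> coord_class n V q = coord_class n V (p * q)"
    and "p \<in> carrier (poly_algebra n) \<Longrightarrow> c \<odot>\<^bsub>A\<^esub> coord_class n V p = coord_class n V (Const c * p)"
proof -
  interpret I: ideal "vanishing_ideal n V" "poly_algebra n" by (rule ideal_vanishing_ideal)
  note defs = A_def coord_algebra_def quot_algebra_def ring.defs module.defs FactRing_def
  show "\<one>\<^bsub>A\<^esub> = coord_class n V 1" by (simp add: defs)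
  show "\<zero>\<^bsub>A\<^esub> = coord_class n V 0"
    unfolding coord_class_0 by (simp add: defs)
  show "coord_class n V p \<oplus>\<^bsub>A\<^esub> coord_class n V q = coord_class n V (p + q)"
    if "p \<in> carrier (poly_algebra n)" "q \<in> carrier (poly_algebra n)"
    using I.a_rcos_sum[OF that] by (simp add: defs)
  show "coord_class n V p \<otimes>\<^bsub>A\<^esub> coord_class n V q = coord_class n V (p * q)"
    if "p \<in> carrier (poly_algebra n)" "q \<in> carrier (poly_algebra n)"
    using I.rcoset_mult_add[OF that] by (simp add: defs)
  show "c \<odot>\<^bsub>A\<^esub> coord_class n V p = coord_class n V (Const c * p)"
    if p: "p \<in> carrier (poly_algebra n)"
  proof -
    \<comment> \<open>Scalar multiplication on the quotient is a union over representatives. All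
      members of the union coincide, and the coset is nonempty, so the union is that one
      coset.\<close>
    have same: "coord_class n V (Const c * q) = coord_class n V (Const c * p)"
      if "q \<in> coord_class n V p" for q
      using that p unfolding coord_class_eq[OF p]
      by (simp add: coord_class_eq poly_algebra_closed mpoly_eval_simps)
    have "p \<in> coord_class n V p" using p by (simp add: coord_class_eq)
    then have "coord_class n V p \<noteq> {}" by blast
    have "c \<odot>\<^bsub>A\<^esub> coord_class n V p = (\<Union>q\<in>coord_class n V p. coord_class n V (Const c * q))"
      by (simp add: defs)
    also have "\<dots> = (\<Union>q\<in>coord_class n V p. coord_class n V (Const c * p))"
      by (rule SUP_cong[OF refl same])
    also have "\<dots> = coord_class n V (Const c * p)"
      by (rule cSUP_const) fact
    finally show ?thesis .
  qed
qed

lemma function_algebra_coord: "function_algebra (coord_algebra n V) V coord_eval"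
proof
  fix x y assume xy: "x \<in> carrier (coord_algebra n V)" "y \<in> carrier (coord_algebra n V)"
    and eq: "\<And>s. s \<in> V \<Longrightarrow> coord_eval s x = coord_eval s y"
  show "x = y"
    by (rule coord_algebra_cases[OF xy(1)], rule coord_algebra_cases[OF xy(2)])
      (use eq in \<open>simp add: coord_class_eq\<close>)
qed (auto simp: coord_algebra_carrier coord_algebra_ops coord_eval_class poly_algebra_closed
    mpoly_eval_simps)

section \<open>Regular functions\<close>

lemmas coord_algebra_closed = function_algebra.fa_closed[OF function_algebra_coord]
  and coord_algebra_eval = function_algebra.fa_eval[OF function_algebra_coord]
  and coord_algebra_eqI = function_algebra.fa_eqI[OF function_algebra_coord]
  and coord_algebra_cring = function_algebra.fa_cring[OF function_algebra_coord]
  and coord_algebra_minus = function_algebra.fa_minus[OF function_algebra_coord]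
  and coord_algebra_pow = function_algebra.fa_pow[OF function_algebra_coord]
  and coord_algebra_alg_eval = function_algebra.fa_alg_eval[OF function_algebra_coord]

lemma openin_variety_topology:
  "openin (variety_topology n V) W \<longleftrightarrow>
     (\<exists>F\<subseteq>carrier (poly_algebra n). W = (affine_space n - zero_set n F) \<inter> V)"
  unfolding variety_topology_def openin_subtopology openin_zariski by blast

lemma openin_variety_topology_subset: "openin (variety_topology n V) W \<Longrightarrow> W \<subseteq> V"
  by (auto simp: openin_variety_topology)

lemma openin_basic_open:
  assumes "V \<subseteq> affine_space n" "h \<in> carrier (coord_algebra n V)"
  shows "openin (variety_topology n V) (basic_open V h)"
proof -
  obtain H where H: "H \<in> carrier (poly_algebra n)" "\<And>P. P \<in> V \<Longrightarrow> coord_eval P h = mpoly_eval P H"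
    using coord_algebra_cases[OF assms(2)] by metis
  then have "basic_open V h = (affine_space n - zero_set n {H}) \<inter> V"
    using assms(1) by (auto simp: basic_open_def zero_set_def)
  then show ?thesis unfolding openin_variety_topology using H(1) by blast
qed

lemma regular_functions_local:
  assumes f: "f \<in> regular_functions n V U" and P: "P \<in> U"
  obtains W g l where "openin (variety_topology n V) W" "P \<in> W" "W \<subseteq> U"
    "g \<in> carrier (coord_algebra n V)" "l \<in> carrier (coord_algebra n V)"
    "\<And>Q. Q \<in> W \<Longrightarrow> coord_eval Q l \<noteq> 0" "\<And>Q. Q \<in> W \<Longrightarrow> f Q = coord_eval Q g / coord_eval Q l"
proof -
  have "\<exists>W. openin (variety_topology n V) W \<and> P \<in> W \<and> W \<subseteq> U \<and>
     (\<exists>g\<in>carrier (coord_algebra n V). \<exists>l\<in>carrier (coord_algebra n V).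
        \<forall>Q\<in>W. coord_eval Q l \<noteq> 0 \<and> f Q = coord_eval Q g / coord_eval Q l)"
    using f P unfolding regular_functions_def by simp
  then obtain W g l where "openin (variety_topology n V) W" "P \<in> W" "W \<subseteq> U"
    "g \<in> carrier (coord_algebra n V)" "l \<in> carrier (coord_algebra n V)"
    "\<forall>Q\<in>W. coord_eval Q l \<noteq> 0 \<and> f Q = coord_eval Q g / coord_eval Q l"
    by (elim exE conjE bexE)
  then show thesis by (intro that[of W g l]) simp_all
qed

lemma regular_functionsI:
  assumes "f \<in> U \<rightarrow>\<^sub>E UNIV"
    and "\<And>P. P \<in> U \<Longrightarrow> \<exists>W g l. openin (variety_topology n V) W \<and> P \<in> W \<and> W \<subseteq> U \<and>
      g \<in> carrier (coord_algebra n V) \<and> l \<in> carrier (coord_algebra n V) \<and>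
      (\<forall>Q\<in>W. coord_eval Q l \<noteq> 0 \<and> f Q = coord_eval Q g / coord_eval Q l)"
  shows "f \<in> regular_functions n V U"
  unfolding regular_functions_def mem_Collect_eq
proof (intro conjI ballI assms(1))
  fix P assume "P \<in> U"
  from assms(2)[OF this] obtain W g l where "openin (variety_topology n V) W" "P \<in> W" "W \<subseteq> U"
    "g \<in> carrier (coord_algebra n V)" "l \<in> carrier (coord_algebra n V)"
    "\<forall>Q\<in>W. coord_eval Q l \<noteq> 0 \<and> f Q = coord_eval Q g / coord_eval Q l"
    by (elim exE conjE) (rule that)
  then show "\<exists>W. openin (variety_topology n V) W \<and> P \<in> W \<and> W \<subseteq> U \<and>
     (\<exists>g\<in>carrier (coord_algebra n V). \<exists>l\<in>carrier (coord_algebra n V).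
        \<forall>Q\<in>W. coord_eval Q l \<noteq> 0 \<and> f Q = coord_eval Q g / coord_eval Q l)"
    by (intro exI[of _ W] conjI bexI[of _ g] bexI[of _ l])
qed

lemma regular_functions_fraction:
  assumes "openin (variety_topology n V) U"
    and "g \<in> carrier (coord_algebra n V)" "l \<in> carrier (coord_algebra n V)"
    and "\<And>P. P \<in> U \<Longrightarrow> coord_eval P l \<noteq> 0"
  shows "(\<lambda>P\<in>U. coord_eval P g / coord_eval P l) \<in> regular_functions n V U"
proof (rule regular_functionsI)
  fix P assume "P \<in> U"
  then show "\<exists>W g' l'. openin (variety_topology n V) W \<and> P \<in> W \<and> W \<subseteq> U \<and>
      g' \<in> carrier (coord_algebra n V) \<and> l' \<in> carrier (coord_algebra n V) \<and>
      (\<forall>Q\<in>W. coord_eval Q l' \<noteq> 0 \<and>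
        (\<lambda>P\<in>U. coord_eval P g / coord_eval P l) Q = coord_eval Q g' / coord_eval Q l')"
    using assms by (intro exI[of _ U] exI[of _ g] exI[of _ l]) simp
qed simp

lemma regular_functions_add:
  assumes f: "f \<in> regular_functions n V U" and f': "f' \<in> regular_functions n V U"
  shows "(\<lambda>P\<in>U. f P + f' P) \<in> regular_functions n V U"
proof (rule regular_functionsI)
  fix P assume P: "P \<in> U"
  obtain W g l where W: "openin (variety_topology n V) W" "P \<in> W" "W \<subseteq> U"
    and g: "g \<in> carrier (coord_algebra n V)" "l \<in> carrier (coord_algebra n V)"
    and eq: "\<And>Q. Q \<in> W \<Longrightarrow> coord_eval Q l \<noteq> 0" "\<And>Q. Q \<in> W \<Longrightarrow> f Q = coord_eval Q g / coord_eval Q l"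
    using regular_functions_local[OF f P] by metis
  obtain W' g' l' where W': "openin (variety_topology n V) W'" "P \<in> W'" "W' \<subseteq> U"
    and g': "g' \<in> carrier (coord_algebra n V)" "l' \<in> carrier (coord_algebra n V)"
    and eq': "\<And>Q. Q \<in> W' \<Longrightarrow> coord_eval Q l' \<noteq> 0" "\<And>Q. Q \<in> W' \<Longrightarrow> f' Q = coord_eval Q g' / coord_eval Q l'"
    using regular_functions_local[OF f' P] by metis
  let ?A = "coord_algebra n V"
  have "Q \<in> V" if "Q \<in> W" for Q using that openin_variety_topology_subset[OF W(1)] by blast
  then show "\<exists>W g l. openin (variety_topology n V) W \<and> P \<in> W \<and> W \<subseteq> U \<and> g \<in> carrier ?A \<and>
      l \<in> carrier ?A \<and> (\<forall>Q\<in>W. coord_eval Q l \<noteq> 0 \<and>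
      (\<lambda>P\<in>U. f P + f' P) Q = coord_eval Q g / coord_eval Q l)"
    using W W' g g' eq eq'
    by (intro exI[of _ "W \<inter> W'"] exI[of _ "g \<otimes>\<^bsub>?A\<^esub> l' \<oplus>\<^bsub>?A\<^esub> g' \<otimes>\<^bsub>?A\<^esub> l"] exI[of _ "l \<otimes>\<^bsub>?A\<^esub> l'"])
      (auto simp: coord_algebra_closed coord_algebra_eval add_frac_eq)
qed simp

lemma regular_functions_mult:
  assumes f: "f \<in> regular_functions n V U" and f': "f' \<in> regular_functions n V U"
  shows "(\<lambda>P\<in>U. f P * f' P) \<in> regular_functions n V U"
proof (rule regular_functionsI)
  fix P assume P: "P \<in> U"
  obtain W g l where W: "openin (variety_topology n V) W" "P \<in> W" "W \<subseteq> U"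
    and g: "g \<in> carrier (coord_algebra n V)" "l \<in> carrier (coord_algebra n V)"
    and eq: "\<And>Q. Q \<in> W \<Longrightarrow> coord_eval Q l \<noteq> 0" "\<And>Q. Q \<in> W \<Longrightarrow> f Q = coord_eval Q g / coord_eval Q l"
    using regular_functions_local[OF f P] by metis
  obtain W' g' l' where W': "openin (variety_topology n V) W'" "P \<in> W'" "W' \<subseteq> U"
    and g': "g' \<in> carrier (coord_algebra n V)" "l' \<in> carrier (coord_algebra n V)"
    and eq': "\<And>Q. Q \<in> W' \<Longrightarrow> coord_eval Q l' \<noteq> 0" "\<And>Q. Q \<in> W' \<Longrightarrow> f' Q = coord_eval Q g' / coord_eval Q l'"
    using regular_functions_local[OF f' P] by metis
  let ?A = "coord_algebra n V"
  have "Q \<in> V" if "Q \<in> W" for Q using that openin_variety_topology_subset[OF W(1)] by blast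
  then show "\<exists>W g l. openin (variety_topology n V) W \<and> P \<in> W \<and> W \<subseteq> U \<and> g \<in> carrier ?A \<and>
      l \<in> carrier ?A \<and> (\<forall>Q\<in>W. coord_eval Q l \<noteq> 0 \<and>
      (\<lambda>P\<in>U. f P * f' P) Q = coord_eval Q g / coord_eval Q l)"
    using W W' g g' eq eq'
    by (intro exI[of _ "W \<inter> W'"] exI[of _ "g \<otimes>\<^bsub>?A\<^esub> g'"] exI[of _ "l \<otimes>\<^bsub>?A\<^esub> l'"])
      (auto simp: coord_algebra_closed coord_algebra_eval)
qed simp

text \<open>Locally the numerator has no zeros, so numerator and denominator can be swapped.\<close>

lemma regular_functions_inverse:
  assumes U: "openin (variety_topology n V) U" and f: "f \<in> regular_functions n V U"
    and nz: "\<And>P. P \<in> U \<Longrightarrow> f P \<noteq> 0"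
  shows "(\<lambda>P\<in>U. 1 / f P) \<in> regular_functions n V U"
proof (rule regular_functionsI)
  fix P assume P: "P \<in> U"
  obtain W g l where W: "openin (variety_topology n V) W" "P \<in> W" "W \<subseteq> U"
    and g: "g \<in> carrier (coord_algebra n V)" "l \<in> carrier (coord_algebra n V)"
    and eq: "\<And>Q. Q \<in> W \<Longrightarrow> coord_eval Q l \<noteq> 0" "\<And>Q. Q \<in> W \<Longrightarrow> f Q = coord_eval Q g / coord_eval Q l"
    using regular_functions_local[OF f P] by metis
  have "coord_eval Q g \<noteq> 0" "(\<lambda>P\<in>U. 1 / f P) Q = coord_eval Q l / coord_eval Q g" if "Q \<in> W" for Q
    using nz[of Q] eq[OF that] that W(3) by auto
  then show "\<exists>W g l. openin (variety_topology n V) W \<and> P \<in> W \<and> W \<subseteq> U \<and>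
      g \<in> carrier (coord_algebra n V) \<and> l \<in> carrier (coord_algebra n V) \<and>
      (\<forall>Q\<in>W. coord_eval Q l \<noteq> 0 \<and> (\<lambda>P\<in>U. 1 / f P) Q = coord_eval Q g / coord_eval Q l)"
    using W g by blast
qed simp

lemma regular_functions_const:
  assumes U: "openin (variety_topology n V) U"
  shows "(\<lambda>P\<in>U. c) \<in> regular_functions n V U"
proof -
  let ?A = "coord_algebra n V"
  have "P \<in> V" if "P \<in> U" for P using that openin_variety_topology_subset[OF U] by blast
  then have "(\<lambda>P\<in>U. c) = (\<lambda>P\<in>U. coord_eval P (c \<odot>\<^bsub>?A\<^esub> \<one>\<^bsub>?A\<^esub>) / coord_eval P \<one>\<^bsub>?A\<^esub>)"
    by (auto simp: restrict_def coord_algebra_eval coord_algebra_closed)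
  also have "\<dots> \<in> regular_functions n V U"
    using openin_variety_topology_subset[OF U]
    by (intro regular_functions_fraction U) (auto simp: coord_algebra_eval coord_algebra_closed)
  finally show ?thesis .
qed

lemma function_algebra_regular:
  assumes U: "openin (variety_topology n V) U"
  shows "function_algebra (regular_algebra n V U) U (\<lambda>P f. f P)"
proof
  fix c :: 'a and f :: "(nat \<Rightarrow> 'a) \<Rightarrow> 'a" assume f: "f \<in> carrier (regular_algebra n V U)"
  \<comment> \<open>Scaling is treated as multiplication by a constant function.\<close>
  then have "(\<lambda>P\<in>U. (\<lambda>P\<in>U. c) P * f P) \<in> regular_functions n V U"
    by (intro regular_functions_mult regular_functions_const U) (simp add: regular_algebra_def)
  then show "c \<odot>\<^bsub>regular_algebra n V U\<^esub> f \<in> carrier (regular_algebra n V U)"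
    by (simp add: regular_algebra_def power_algebra_def cong: restrict_cong)
next
  fix f g :: "(nat \<Rightarrow> 'a) \<Rightarrow> 'a"
  assume "f \<in> carrier (regular_algebra n V U)" "g \<in> carrier (regular_algebra n V U)"
    and "\<And>P. P \<in> U \<Longrightarrow> f P = g P"
  then show "f = g" by (intro PiE_ext[of f U "\<lambda>_. UNIV" g]) (auto simp: regular_algebra_def regular_functions_def)
next
  fix f g :: "(nat \<Rightarrow> 'a) \<Rightarrow> 'a"
  assume "f \<in> carrier (regular_algebra n V U)" "g \<in> carrier (regular_algebra n V U)"
  then have "f \<in> regular_functions n V U" "g \<in> regular_functions n V U"
    by (simp_all add: regular_algebra_def)
  from regular_functions_add[OF this] regular_functions_mult[OF this]
  show "f \<oplus>\<^bsub>regular_algebra n V U\<^esub> g \<in> carrier (regular_algebra n V U)"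
    "f \<otimes>\<^bsub>regular_algebra n V U\<^esub> g \<in> carrier (regular_algebra n V U)"
    by (simp_all add: regular_algebra_def power_algebra_def)
qed (simp_all add: regular_algebra_def power_algebra_def regular_functions_const[OF U])

text \<open>Sections are already functions on \<open>U\<close>, so the inclusion is the embedding;
  for empty \<open>U\<close> it is the zero algebra in the empty power.\<close>

lemma essential_regular_algebra:
  assumes U: "openin (variety_topology n V) U"
  shows "essential (regular_algebra n V U)"
proof (rule essentialI)
  interpret function_algebra "regular_algebra n V U" U "\<lambda>P f. f P"
    by (rule function_algebra_regular[OF U])
  show "kalg_hom (regular_algebra n V U) (power_algebra U) (\<lambda>f. f)"
    unfolding kalg_hom_def using fa_kalgebra kalgebra_power[of U]
    by (auto simp: ring_hom_def regular_algebra_def power_algebra_def regular_functions_def)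
qed simp

text \<open>The value at a point is a value of \<open>D\<close> in the field, hence nonzero, and the
  pointwise inverse is again regular.\<close>

lemma star_algebra_regular_algebra:
  assumes U: "openin (variety_topology n V) U"
  shows "star_algebra (regular_algebra n V U)"
proof -
  interpret function_algebra "regular_algebra n V U" U "\<lambda>P f. f P"
    by (rule function_algebra_regular[OF U])
  let ?R = "regular_algebra n V U"
  have "alg_eval ?R b D \<in> Units ?R"
    if D: "D \<in> alg_signature" and b: "b \<in> UNIV \<rightarrow> carrier ?R" for D b
  proof -
    let ?f = "alg_eval ?R b D"
    let ?g = "\<lambda>P\<in>U. 1 / ?f P"
    have f: "?f \<in> carrier ?R" by (rule fa_alg_eval[OF b])
    have nz: "?f P \<noteq> 0" if "P \<in> U" for P
      using D fa_alg_eval(2)[OF b that, of D] by (simp add: alg_signature_def)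
    have g: "?g \<in> carrier ?R"
      using regular_functions_inverse[OF U, of ?f] f nz by (simp add: regular_algebra_def)
    have "?g \<otimes>\<^bsub>?R\<^esub> ?f = \<one>\<^bsub>?R\<^esub>" "?f \<otimes>\<^bsub>?R\<^esub> ?g = \<one>\<^bsub>?R\<^esub>"
      using f g nz by (auto intro!: fa_eqI simp: fa_closed fa_eval)
    then show ?thesis using f g by (auto simp: Units_def)
  qed
  then show ?thesis using fa_kalgebra by (simp add: star_algebra_def)
qed

section \<open>The sheaf axioms\<close>

lemma regular_functions_restrict:
  assumes f: "f \<in> regular_functions n V U" and W: "openin (variety_topology n V) W" "W \<subseteq> U"
  shows "restrict f W \<in> regular_functions n V W"
proof (rule regular_functionsI)
  fix P assume P: "P \<in> W"
  then have "P \<in> U" using W(2) by blast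
  then obtain W' g l where W': "openin (variety_topology n V) W'" "P \<in> W'"
    and g: "g \<in> carrier (coord_algebra n V)" "l \<in> carrier (coord_algebra n V)"
    and eq: "\<And>Q. Q \<in> W' \<Longrightarrow> coord_eval Q l \<noteq> 0" "\<And>Q. Q \<in> W' \<Longrightarrow> f Q = coord_eval Q g / coord_eval Q l"
    using regular_functions_local[OF f] by metis
  show "\<exists>W' g l. openin (variety_topology n V) W' \<and> P \<in> W' \<and> W' \<subseteq> W \<and>
      g \<in> carrier (coord_algebra n V) \<and> l \<in> carrier (coord_algebra n V) \<and>
      (\<forall>Q\<in>W'. coord_eval Q l \<noteq> 0 \<and> restrict f W Q = coord_eval Q g / coord_eval Q l)"
    using W' P W(1) g eq by (intro exI[of _ "W \<inter> W'"] exI[of _ g] exI[of _ l]) auto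
qed simp

lemma kalg_sheaf_regular_algebra:
  fixes V :: "(nat \<Rightarrow> 'k::field) set"
  shows "kalg_sheaf (variety_topology n V) (regular_algebra n V) (\<lambda>U W f. restrict f W)"
  unfolding kalg_sheaf_def
proof (intro conjI allI impI ballI)
  fix U W :: "(nat \<Rightarrow> 'k) set"
  assume "openin (variety_topology n V) U \<and> openin (variety_topology n V) W \<and> W \<subseteq> U"
  then have U: "openin (variety_topology n V) U" and W: "openin (variety_topology n V) W" "W \<subseteq> U"
    by auto
  show "kalg_hom (regular_algebra n V U) (regular_algebra n V W) (\<lambda>f. restrict f W)"
    unfolding kalg_hom_def
    using function_algebra.fa_kalgebra[OF function_algebra_regular[OF U]]
      function_algebra.fa_kalgebra[OF function_algebra_regular[OF W(1)]]
      regular_functions_restrict[OF _ W] W(2)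
    by (auto simp: ring_hom_def regular_algebra_def power_algebra_def fun_eq_iff restrict_def)
next
  fix U f assume "f \<in> carrier (regular_algebra n V U)"
  then show "restrict f U = f"
    by (auto simp: regular_algebra_def regular_functions_def PiE_iff extensional_restrict)
next
  fix U W Z :: "(nat \<Rightarrow> 'k) set" and f :: "(nat \<Rightarrow> 'k) \<Rightarrow> 'k"
  assume "openin (variety_topology n V) U \<and> openin (variety_topology n V) W \<and>
    openin (variety_topology n V) Z \<and> Z \<subseteq> W \<and> W \<subseteq> U"
  then show "restrict (restrict f W) Z = restrict f Z" by (simp add: Int_absorb1)
next
  fix \<U> :: "(nat \<Rightarrow> 'k) set set" and f g
  assume f: "f \<in> carrier (regular_algebra n V (\<Union>\<U>))" "g \<in> carrier (regular_algebra n V (\<Union>\<U>))"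
    and eq: "\<forall>W\<in>\<U>. restrict f W = restrict g W"
  show "f = g"
  proof (rule PiE_ext)
    show "f \<in> \<Union>\<U> \<rightarrow>\<^sub>E UNIV" "g \<in> \<Union>\<U> \<rightarrow>\<^sub>E UNIV"
      using f by (auto simp: regular_algebra_def regular_functions_def)
    show "f P = g P" if "P \<in> \<Union>\<U>" for P
      using that eq by (metis UnionE restrict_apply')
  qed
next
  fix \<U> :: "(nat \<Rightarrow> 'k) set set" and s
  assume "(\<forall>W\<in>\<U>. openin (variety_topology n V) W \<and> s W \<in> carrier (regular_algebra n V W)) \<and>
    (\<forall>W\<in>\<U>. \<forall>Z\<in>\<U>. restrict (s W) (W \<inter> Z) = restrict (s Z) (W \<inter> Z))"
  then have op: "\<And>W. W \<in> \<U> \<Longrightarrow> openin (variety_topology n V) W"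
    and s: "\<And>W. W \<in> \<U> \<Longrightarrow> s W \<in> regular_functions n V W"
    and comp: "\<And>W Z. W \<in> \<U> \<Longrightarrow> Z \<in> \<U> \<Longrightarrow> restrict (s W) (W \<inter> Z) = restrict (s Z) (W \<inter> Z)"
    by (auto simp: regular_algebra_def)
  \<comment> \<open>Compatibility on intersections makes the value independent of the chosen member
    of the cover.\<close>
  define f where "f = (\<lambda>P\<in>\<Union>\<U>. s (SOME W. W \<in> \<U> \<and> P \<in> W) P)"
  have f: "f P = s W P" if W: "W \<in> \<U>" "P \<in> W" for W P
  proof -
    let ?Z = "SOME Z. Z \<in> \<U> \<and> P \<in> Z"
    have Z: "?Z \<in> \<U> \<and> P \<in> ?Z" by (rule someI[of _ W]) (use W in simp)
    have "s ?Z P = s W P"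
      using fun_cong[OF comp[of ?Z W], of P] Z W by simp
    then show ?thesis using W by (auto simp: f_def)
  qed
  show "\<exists>f\<in>carrier (regular_algebra n V (\<Union>\<U>)). \<forall>W\<in>\<U>. restrict f W = s W"
  proof (intro bexI[of _ f] ballI)
    fix W assume W: "W \<in> \<U>"
    show "restrict f W = s W"
      by (rule PiE_ext[of _ W "\<lambda>_. UNIV"])
        (use s[OF W] W in \<open>auto simp: f regular_functions_def\<close>)
  next
    have "f \<in> regular_functions n V (\<Union>\<U>)"
    proof (rule regular_functionsI)
      fix P assume "P \<in> \<Union>\<U>"
      then obtain W where W: "W \<in> \<U>" "P \<in> W" by blast
      obtain W' g l where W': "openin (variety_topology n V) W'" "P \<in> W'" "W' \<subseteq> W"
        and g: "g \<in> carrier (coord_algebra n V)" "l \<in> carrier (coord_algebra n V)"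
        and eq: "\<And>Q. Q \<in> W' \<Longrightarrow> coord_eval Q l \<noteq> 0"
          "\<And>Q. Q \<in> W' \<Longrightarrow> s W Q = coord_eval Q g / coord_eval Q l"
        using regular_functions_local[OF s[OF W(1)] W(2)] by metis
      \<comment> \<open>Regularity is local: the fraction that represents \<open>s W\<close> near
        \<open>P\<close> also represents \<open>f\<close>.\<close>
      have "f Q = s W Q" if "Q \<in> W'" for Q using f[OF W(1)] that W'(3) by blast
      then show "\<exists>W g l. openin (variety_topology n V) W \<and> P \<in> W \<and> W \<subseteq> \<Union>\<U> \<and>
          g \<in> carrier (coord_algebra n V) \<and> l \<in> carrier (coord_algebra n V) \<and>
          (\<forall>Q\<in>W. coord_eval Q l \<noteq> 0 \<and> f Q = coord_eval Q g / coord_eval Q l)"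
        using W' W(1) g eq by (intro exI[of _ W'] exI[of _ g] exI[of _ l]) auto
    qed (simp add: f_def)
    then show "f \<in> carrier (regular_algebra n V (\<Union>\<U>))" by (simp add: regular_algebra_def)
  qed
qed

section \<open>The localization\<close>

text \<open>On D(h) a generator is a power of \<open>h\<close> times a value of \<open>D\<close>, by
  \<open>mpoly_eval_homogenize\<close>, and \<open>D\<close> has no zeros.\<close>

lemma Sigma_set_coord:
  assumes h: "h \<in> carrier (coord_algebra n V)" and \<alpha>: "\<alpha> \<in> Sigma_set (coord_algebra n V) h"
  shows "\<alpha> \<in> carrier (coord_algebra n V)" "P \<in> basic_open V h \<Longrightarrow> coord_eval P \<alpha> \<noteq> 0"
proof -
  let ?A = "coord_algebra n V"
  have "\<alpha> \<in> carrier ?A \<and> (\<forall>P\<in>basic_open V h. coord_eval P \<alpha> \<noteq> 0)"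
    using \<alpha>
  proof (induction rule: Sigma_set.induct)
    case one
    then show ?case by (simp add: coord_algebra_closed coord_algebra_eval basic_open_def)
  next
    case (gen D b m k)
    let ?b = "case_option (h [^]\<^bsub>?A\<^esub> k) b"
    have b: "?b \<in> UNIV \<rightarrow> carrier ?A"
      using gen.hyps(2) by (auto simp: Pi_iff coord_algebra_pow h split: option.split)
    have "coord_eval P (h [^]\<^bsub>?A\<^esub> m \<otimes>\<^bsub>?A\<^esub> alg_eval ?A ?b (homogenize D)) \<noteq> 0"
      if P: "P \<in> basic_open V h" for P
    proof -
      have PV: "P \<in> V" and nz: "coord_eval P h \<noteq> 0" using P by (auto simp: basic_open_def)
      then show ?thesis
        using gen.hyps(1) coord_algebra_alg_eval(1)[OF b, of "homogenize D"]
          coord_algebra_alg_eval(2)[OF b PV, of "homogenize D"]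
        by (simp add: coord_algebra_eval coord_algebra_pow h mpoly_eval_homogenize alg_signature_def)
    qed
    then show ?case using coord_algebra_alg_eval(1)[OF b] by (simp add: coord_algebra_closed coord_algebra_pow h)
  next
    case (mult x y)
    then show ?case by (auto simp: coord_algebra_closed coord_algebra_eval basic_open_def)
  qed
  then show "\<alpha> \<in> carrier ?A" "P \<in> basic_open V h \<Longrightarrow> coord_eval P \<alpha> \<noteq> 0" by auto
qed

text \<open>The generator for \<open>D = 1\<close> and \<open>m = 1\<close>, since the
  homogenization of 1 is 1.\<close>

lemma self_in_Sigma_set:
  assumes h: "h \<in> carrier (coord_algebra n V)"
  shows "h \<in> Sigma_set (coord_algebra n V) h"
proof -
  let ?A = "coord_algebra n V"
  let ?b = "\<lambda>_ :: nat. \<one>\<^bsub>?A\<^esub>"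
  define \<beta> where "\<beta> = alg_eval ?A (case_option (h [^]\<^bsub>?A\<^esub> (0::nat)) ?b) (homogenize 1)"
  have b: "case_option (h [^]\<^bsub>?A\<^esub> (0::nat)) ?b \<in> UNIV \<rightarrow> carrier ?A"
    by (auto simp: coord_algebra_closed coord_algebra_pow h split: option.split)
  have \<beta>: "\<beta> \<in> carrier ?A" "\<And>P. P \<in> V \<Longrightarrow> coord_eval P \<beta> = 1"
    unfolding \<beta>_def using coord_algebra_alg_eval[OF b, where p = "homogenize 1"]
    by (simp_all add: homogenize_1)
  have "h [^]\<^bsub>?A\<^esub> (1::nat) \<otimes>\<^bsub>?A\<^esub> \<beta> \<in> Sigma_set ?A h"
    unfolding \<beta>_def by (rule Sigma_set.gen) (auto simp: alg_signature_def coord_algebra_closed)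
  moreover have "h [^]\<^bsub>?A\<^esub> (1::nat) \<otimes>\<^bsub>?A\<^esub> \<beta> = h"
    by (rule coord_algebra_eqI[where n = n and S = V])
      (use \<beta> h in \<open>simp_all add: coord_algebra_closed coord_algebra_eval coord_algebra_pow\<close>)
  ultimately show ?thesis by simp
qed

text \<open>The annihilator \<open>u\<close> in \<open>loc_rel\<close> can be cancelled at points of
  D(h), where it is nonzero; conversely \<open>u = h\<close> will do. Classes are thus described by
  values alone, and their equality becomes a pointwise question.\<close>

lemma loc_frac_coord:
  fixes n V h
  defines "A \<equiv> coord_algebra n V" and "\<Sigma> \<equiv> Sigma_set (coord_algebra n V) h"
  assumes h: "h \<in> carrier A" and a: "a \<in> carrier A" and s: "s \<in> \<Sigma>"
  shows "loc_frac A \<Sigma> a s = {(b, t). b \<in> carrier A \<and> t \<in> \<Sigma> \<and>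
    (\<forall>P\<in>basic_open V h. coord_eval P a / coord_eval P s = coord_eval P b / coord_eval P t)}"
proof -
  interpret cring A unfolding A_def by (rule coord_algebra_cring)
  note closed = Sigma_set_coord(1)[OF h[unfolded A_def], folded A_def \<Sigma>_def]
  note nz = Sigma_set_coord(2)[OF h[unfolded A_def], folded \<Sigma>_def]
  have "(\<exists>u\<in>\<Sigma>. u \<otimes>\<^bsub>A\<^esub> (a \<otimes>\<^bsub>A\<^esub> t \<ominus>\<^bsub>A\<^esub> b \<otimes>\<^bsub>A\<^esub> s) = \<zero>\<^bsub>A\<^esub>) \<longleftrightarrow>
      (\<forall>P\<in>basic_open V h. coord_eval P a / coord_eval P s = coord_eval P b / coord_eval P t)"
    if b: "b \<in> carrier A" and t: "t \<in> \<Sigma>" for b t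
  proof -
    have carr: "s \<in> carrier A" "t \<in> carrier A" using closed s t by auto
    have ev: "coord_eval P (u \<otimes>\<^bsub>A\<^esub> (a \<otimes>\<^bsub>A\<^esub> t \<ominus>\<^bsub>A\<^esub> b \<otimes>\<^bsub>A\<^esub> s)) =
        coord_eval P u * (coord_eval P a * coord_eval P t - coord_eval P b * coord_eval P s)"
      if "P \<in> V" "u \<in> carrier A" for P u
      using that a b carr unfolding A_def
      by (simp add: coord_algebra_eval coord_algebra_minus coord_algebra_closed
          cring.cring_simprules(4)[OF coord_algebra_cring])
    have frac: "coord_eval P a / coord_eval P s = coord_eval P b / coord_eval P t \<longleftrightarrow>
        coord_eval P a * coord_eval P t - coord_eval P b * coord_eval P s = 0"
      if "P \<in> basic_open V h" for P
      using nz[OF s that] nz[OF t that] by (simp add: frac_eq_eq)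
    show ?thesis
    proof
      assume "\<exists>u\<in>\<Sigma>. u \<otimes>\<^bsub>A\<^esub> (a \<otimes>\<^bsub>A\<^esub> t \<ominus>\<^bsub>A\<^esub> b \<otimes>\<^bsub>A\<^esub> s) = \<zero>\<^bsub>A\<^esub>"
      then obtain u where u: "u \<in> \<Sigma>" "u \<otimes>\<^bsub>A\<^esub> (a \<otimes>\<^bsub>A\<^esub> t \<ominus>\<^bsub>A\<^esub> b \<otimes>\<^bsub>A\<^esub> s) = \<zero>\<^bsub>A\<^esub>" by blast
      show "\<forall>P\<in>basic_open V h. coord_eval P a / coord_eval P s = coord_eval P b / coord_eval P t"
      proof
        fix P assume P: "P \<in> basic_open V h"
        then have "P \<in> V" by (simp add: basic_open_def)
        then have "coord_eval P u * (coord_eval P a * coord_eval P t - coord_eval P b * coord_eval P s) = 0"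
          using ev[of P u] closed[OF u(1)] u(2) coord_algebra_eval(1)[of P V n] by (simp add: A_def)
        then show "coord_eval P a / coord_eval P s = coord_eval P b / coord_eval P t"
          using nz[OF u(1) P] frac[OF P] by simp
      qed
    next
      assume eq: "\<forall>P\<in>basic_open V h. coord_eval P a / coord_eval P s = coord_eval P b / coord_eval P t"
      have "h \<otimes>\<^bsub>A\<^esub> (a \<otimes>\<^bsub>A\<^esub> t \<ominus>\<^bsub>A\<^esub> b \<otimes>\<^bsub>A\<^esub> s) = \<zero>\<^bsub>A\<^esub>"
        unfolding A_def
      proof (rule coord_algebra_eqI[where n = n and S = V], fold A_def)
        fix P assume P: "P \<in> V"
        have "coord_eval P h = 0 \<or>
            coord_eval P a * coord_eval P t - coord_eval P b * coord_eval P s = 0"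
          using frac[of P] eq P by (auto simp: basic_open_def)
        then show "coord_eval P (h \<otimes>\<^bsub>A\<^esub> (a \<otimes>\<^bsub>A\<^esub> t \<ominus>\<^bsub>A\<^esub> b \<otimes>\<^bsub>A\<^esub> s)) = coord_eval P \<zero>\<^bsub>A\<^esub>"
          using ev[OF P h] coord_algebra_eval(1)[OF P, of n] by (simp add: A_def)
      qed (use a b carr h in auto)
      then show "\<exists>u\<in>\<Sigma>. u \<otimes>\<^bsub>A\<^esub> (a \<otimes>\<^bsub>A\<^esub> t \<ominus>\<^bsub>A\<^esub> b \<otimes>\<^bsub>A\<^esub> s) = \<zero>\<^bsub>A\<^esub>"
        using self_in_Sigma_set h unfolding A_def \<Sigma>_def by blast
    qed
  qed
  then show ?thesis using a s unfolding loc_frac_def loc_rel_def by auto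
qed

lemma natural_map_loc_frac:
  assumes h: "h \<in> carrier (coord_algebra n V)" and a: "a \<in> carrier (coord_algebra n V)"
    and s: "s \<in> Sigma_set (coord_algebra n V) h"
  shows "natural_map V h (loc_frac (coord_algebra n V) (Sigma_set (coord_algebra n V) h) a s) =
    (\<lambda>P\<in>basic_open V h. coord_eval P a / coord_eval P s)"
proof -
  let ?C = "loc_frac (coord_algebra n V) (Sigma_set (coord_algebra n V) h) a s"
  have "(\<lambda>(g, \<alpha>). coord_eval P g / coord_eval P \<alpha>) ` ?C = {coord_eval P a / coord_eval P s}"
    if "P \<in> basic_open V h" for P
    using that a s unfolding loc_frac_coord[OF h a s] by force
  then show ?thesis unfolding natural_map_def by (intro restrict_ext) simp
qed

text \<open>Resolves the operations of \<open>localization\<close>, which are unions over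
  representatives: once the result is independent of the choice, the union over a nonempty class is
  that result.\<close>

lemma UN_case_prod_const:
  assumes "K \<noteq> {}" "\<And>a b. (a, b) \<in> K \<Longrightarrow> f a b = c"
  shows "(\<Union>(a, b)\<in>K. f a b) = c"
proof -
  have "(case p of (a, b) \<Rightarrow> f a b) = c" if "p \<in> K" for p
    using assms(2) that by (cases p) simp
  then have "(\<Union>(a, b)\<in>K. f a b) = (\<Union>p\<in>K. c)" by (intro SUP_cong refl)
  then show ?thesis using assms(1) by simp
qed

lemma loc_frac_coord_eqI:
  assumes h: "h \<in> carrier (coord_algebra n V)"
    and "a \<in> carrier (coord_algebra n V)" "s \<in> Sigma_set (coord_algebra n V) h"
    and "b \<in> carrier (coord_algebra n V)" "t \<in> Sigma_set (coord_algebra n V) h"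
    and "\<And>P. P \<in> basic_open V h \<Longrightarrow> coord_eval P a / coord_eval P s = coord_eval P b / coord_eval P t"
  shows "loc_frac (coord_algebra n V) (Sigma_set (coord_algebra n V) h) a s =
    loc_frac (coord_algebra n V) (Sigma_set (coord_algebra n V) h) b t"
  unfolding loc_frac_coord[OF h assms(2,3)] loc_frac_coord[OF h assms(4,5)] by (simp add: assms(6) cong: ball_cong)

lemma Sigma_localization_cases:
  assumes h: "h \<in> carrier (coord_algebra n V)"
    and "x \<in> carrier (Sigma_localization (coord_algebra n V) h)"
  obtains a s where "a \<in> carrier (coord_algebra n V)" "s \<in> Sigma_set (coord_algebra n V) h"
    "x = loc_frac (coord_algebra n V) (Sigma_set (coord_algebra n V) h) a s"
  using assms(2) unfolding Sigma_localization_def localization_def loc_frac_def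
  by (auto elim!: quotientE)

lemma Sigma_localization_frac_closed:
  assumes "a \<in> carrier (coord_algebra n V)" "s \<in> Sigma_set (coord_algebra n V) h"
  shows "loc_frac (coord_algebra n V) (Sigma_set (coord_algebra n V) h) a s
    \<in> carrier (Sigma_localization (coord_algebra n V) h)"
  using assms unfolding Sigma_localization_def localization_def loc_frac_def
  by (auto intro!: quotientI)

text \<open>Independence of representatives is fraction arithmetic in the field, since
  \<open>loc_frac_coord\<close> compares classes by their values on D(h).\<close>

lemma Sigma_localization_ops:
  fixes n V h
  defines "A \<equiv> coord_algebra n V" and "\<Sigma> \<equiv> Sigma_set (coord_algebra n V) h"
  defines "L \<equiv> Sigma_localization (coord_algebra n V) h"
  assumes h: "h \<in> carrier A"
    and a: "a \<in> carrier A" and s: "s \<in> \<Sigma>"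
  shows "\<lbrakk>b \<in> carrier A; t \<in> \<Sigma>\<rbrakk> \<Longrightarrow>
      loc_frac A \<Sigma> a s \<otimes>\<^bsub>L\<^esub> loc_frac A \<Sigma> b t = loc_frac A \<Sigma> (a \<otimes>\<^bsub>A\<^esub> b) (s \<otimes>\<^bsub>A\<^esub> t)"
    and "\<lbrakk>b \<in> carrier A; t \<in> \<Sigma>\<rbrakk> \<Longrightarrow> loc_frac A \<Sigma> a s \<oplus>\<^bsub>L\<^esub> loc_frac A \<Sigma> b t =
      loc_frac A \<Sigma> (a \<otimes>\<^bsub>A\<^esub> t \<oplus>\<^bsub>A\<^esub> b \<otimes>\<^bsub>A\<^esub> s) (s \<otimes>\<^bsub>A\<^esub> t)"
    and "c \<odot>\<^bsub>L\<^esub> loc_frac A \<Sigma> a s = loc_frac A \<Sigma> (c \<odot>\<^bsub>A\<^esub> a) s"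
proof -
  note closed = Sigma_set_coord(1)[OF h[unfolded A_def], folded A_def \<Sigma>_def]
  note nz = Sigma_set_coord(2)[OF h[unfolded A_def], folded \<Sigma>_def]
  note frac = loc_frac_coord[OF h[unfolded A_def], folded A_def \<Sigma>_def]
  note eqI = loc_frac_coord_eqI[OF h[unfolded A_def], folded A_def \<Sigma>_def]
  note fa = coord_algebra_closed[where n = n and S = V, folded A_def] coord_algebra_eval[where n = n and S = V, folded A_def]
  have nonempty: "loc_frac A \<Sigma> a s \<noteq> {}" if "a \<in> carrier A" "s \<in> \<Sigma>" for a s
    using frac[OF that] that by auto
  have mult\<Sigma>: "s \<otimes>\<^bsub>A\<^esub> t \<in> \<Sigma>" if "s \<in> \<Sigma>" "t \<in> \<Sigma>" for s t
    using that unfolding A_def \<Sigma>_def by (rule Sigma_set.mult)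
  have DV: "P \<in> V" if "P \<in> basic_open V h" for P using that by (simp add: basic_open_def)
  note L = L_def Sigma_localization_def localization_def A_def[symmetric] \<Sigma>_def[folded A_def, symmetric]
  show "loc_frac A \<Sigma> a s \<otimes>\<^bsub>L\<^esub> loc_frac A \<Sigma> b t = loc_frac A \<Sigma> (a \<otimes>\<^bsub>A\<^esub> b) (s \<otimes>\<^bsub>A\<^esub> t)"
    if b: "b \<in> carrier A" and t: "t \<in> \<Sigma>"
  proof -
    have same: "loc_frac A \<Sigma> (a' \<otimes>\<^bsub>A\<^esub> b') (s' \<otimes>\<^bsub>A\<^esub> t') = loc_frac A \<Sigma> (a \<otimes>\<^bsub>A\<^esub> b) (s \<otimes>\<^bsub>A\<^esub> t)"
      if 1: "(a', s') \<in> loc_frac A \<Sigma> a s" and 2: "(b', t') \<in> loc_frac A \<Sigma> b t" for a' s' b' t'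
    proof (rule eqI)
      fix P assume P: "P \<in> basic_open V h"
      then have "coord_eval P a' / coord_eval P s' * (coord_eval P b' / coord_eval P t') =
          coord_eval P a / coord_eval P s * (coord_eval P b / coord_eval P t)"
        using 1 2 unfolding frac[OF a s] frac[OF b t] by simp
      then show "coord_eval P (a' \<otimes>\<^bsub>A\<^esub> b') / coord_eval P (s' \<otimes>\<^bsub>A\<^esub> t') =
          coord_eval P (a \<otimes>\<^bsub>A\<^esub> b) / coord_eval P (s \<otimes>\<^bsub>A\<^esub> t)"
        using 1 2 DV[OF P] a b closed s t unfolding frac[OF a s] frac[OF b t] by (simp add: fa)
    qed (use 1 2 a b s t in \<open>auto simp: frac[OF a s] frac[OF b t] fa mult\<Sigma>\<close>)
    show ?thesis
      unfolding L module.simps ring.simps monoid.simps partial_object.simps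
      by (rule UN_case_prod_const[OF nonempty[OF a s]],
          rule UN_case_prod_const[OF nonempty[OF b t]], rule same)
  qed
  show "loc_frac A \<Sigma> a s \<oplus>\<^bsub>L\<^esub> loc_frac A \<Sigma> b t =
      loc_frac A \<Sigma> (a \<otimes>\<^bsub>A\<^esub> t \<oplus>\<^bsub>A\<^esub> b \<otimes>\<^bsub>A\<^esub> s) (s \<otimes>\<^bsub>A\<^esub> t)"
    if b: "b \<in> carrier A" and t: "t \<in> \<Sigma>"
  proof -
    have same: "loc_frac A \<Sigma> (a' \<otimes>\<^bsub>A\<^esub> t' \<oplus>\<^bsub>A\<^esub> b' \<otimes>\<^bsub>A\<^esub> s') (s' \<otimes>\<^bsub>A\<^esub> t') =
        loc_frac A \<Sigma> (a \<otimes>\<^bsub>A\<^esub> t \<oplus>\<^bsub>A\<^esub> b \<otimes>\<^bsub>A\<^esub> s) (s \<otimes>\<^bsub>A\<^esub> t)"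
      if 1: "(a', s') \<in> loc_frac A \<Sigma> a s" and 2: "(b', t') \<in> loc_frac A \<Sigma> b t" for a' s' b' t'
    proof (rule eqI)
      fix P assume P: "P \<in> basic_open V h"
      have st: "s' \<in> \<Sigma>" "t' \<in> \<Sigma>" "a' \<in> carrier A" "b' \<in> carrier A"
        using 1 2 unfolding frac[OF a s] frac[OF b t] by auto
      have "coord_eval P a' / coord_eval P s' + coord_eval P b' / coord_eval P t' =
          coord_eval P a / coord_eval P s + coord_eval P b / coord_eval P t"
        using 1 2 P unfolding frac[OF a s] frac[OF b t] by simp
      then show "coord_eval P (a' \<otimes>\<^bsub>A\<^esub> t' \<oplus>\<^bsub>A\<^esub> b' \<otimes>\<^bsub>A\<^esub> s') / coord_eval P (s' \<otimes>\<^bsub>A\<^esub> t') =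
          coord_eval P (a \<otimes>\<^bsub>A\<^esub> t \<oplus>\<^bsub>A\<^esub> b \<otimes>\<^bsub>A\<^esub> s) / coord_eval P (s \<otimes>\<^bsub>A\<^esub> t)"
        using DV[OF P] a b closed s t st nz[OF s P] nz[OF t P] nz[OF st(1) P] nz[OF st(2) P]
        by (simp add: fa add_frac_eq)
    qed (use 1 2 a b s t in \<open>auto simp: frac[OF a s] frac[OF b t] fa mult\<Sigma> closed\<close>)
    show ?thesis
      unfolding L module.simps ring.simps monoid.simps partial_object.simps
      by (rule UN_case_prod_const[OF nonempty[OF a s]],
          rule UN_case_prod_const[OF nonempty[OF b t]], rule same)
  qed
  show "c \<odot>\<^bsub>L\<^esub> loc_frac A \<Sigma> a s = loc_frac A \<Sigma> (c \<odot>\<^bsub>A\<^esub> a) s"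
  proof -
    have same: "loc_frac A \<Sigma> (c \<odot>\<^bsub>A\<^esub> a') s' = loc_frac A \<Sigma> (c \<odot>\<^bsub>A\<^esub> a) s"
      if 1: "(a', s') \<in> loc_frac A \<Sigma> a s" for a' s'
    proof (rule eqI)
      fix P assume P: "P \<in> basic_open V h"
      then have "coord_eval P a' / coord_eval P s' = coord_eval P a / coord_eval P s"
        using 1 unfolding frac[OF a s] by simp
      then show "coord_eval P (c \<odot>\<^bsub>A\<^esub> a') / coord_eval P s' = coord_eval P (c \<odot>\<^bsub>A\<^esub> a) / coord_eval P s"
        using 1 DV[OF P] a unfolding frac[OF a s] by (simp add: fa flip: times_divide_eq_right)
    qed (use 1 a s in \<open>auto simp: frac[OF a s] fa\<close>)
    show ?thesis
      unfolding L module.simps by (rule UN_case_prod_const[OF nonempty[OF a s]], rule same)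
  qed
qed

section \<open>The natural morphism\<close>

text \<open>Evaluation goes through the natural map, so the separation axiom \<open>fa_eqI\<close>
  contains the injectivity of that map.\<close>

lemma function_algebra_Sigma_localization:
  assumes h: "h \<in> carrier (coord_algebra n V)"
  shows "function_algebra (Sigma_localization (coord_algebra n V) h) (basic_open V h)
    (\<lambda>P x. natural_map V h x P)"
proof -
  let ?A = "coord_algebra n V" and ?\<Sigma> = "Sigma_set (coord_algebra n V) h"
  let ?L = "Sigma_localization (coord_algebra n V) h"
  note cases = Sigma_localization_cases[OF h]
  note \<Sigma> = Sigma_set_coord[OF h]
  note ops = Sigma_localization_ops[OF h]
  note nat = natural_map_loc_frac[OF h]
  have DV: "P \<in> V" if "P \<in> basic_open V h" for P using that by (simp add: basic_open_def)
  have mult\<Sigma>: "s \<otimes>\<^bsub>?A\<^esub> t \<in> ?\<Sigma>" if "s \<in> ?\<Sigma>" "t \<in> ?\<Sigma>" for s t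
    using that by (rule Sigma_set.mult)
  have one\<Sigma>: "\<one>\<^bsub>?A\<^esub> \<in> ?\<Sigma>" by (rule Sigma_set.one)
  have one: "\<one>\<^bsub>?L\<^esub> = loc_frac ?A ?\<Sigma> \<one>\<^bsub>?A\<^esub> \<one>\<^bsub>?A\<^esub>"
    and zero: "\<zero>\<^bsub>?L\<^esub> = loc_frac ?A ?\<Sigma> \<zero>\<^bsub>?A\<^esub> \<one>\<^bsub>?A\<^esub>"
    by (simp_all add: Sigma_localization_def localization_def)
  note cl = Sigma_localization_frac_closed
  show ?thesis
  proof
    show "\<zero>\<^bsub>?L\<^esub> \<in> carrier ?L" "\<one>\<^bsub>?L\<^esub> \<in> carrier ?L"
      unfolding one zero by (intro cl one\<Sigma> coord_algebra_closed)+
    fix x y assume xy: "x \<in> carrier ?L" "y \<in> carrier ?L"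
    obtain a s where x: "a \<in> carrier ?A" "s \<in> ?\<Sigma>" "x = loc_frac ?A ?\<Sigma> a s" using cases[OF xy(1)] .
    obtain b t where y: "b \<in> carrier ?A" "t \<in> ?\<Sigma>" "y = loc_frac ?A ?\<Sigma> b t" using cases[OF xy(2)] .
    show "x \<oplus>\<^bsub>?L\<^esub> y \<in> carrier ?L" "x \<otimes>\<^bsub>?L\<^esub> y \<in> carrier ?L"
      unfolding x(3) y(3) ops(1,2)[OF x(1,2) y(1,2)]
      by (intro cl mult\<Sigma> coord_algebra_closed x y \<Sigma>(1))+
    show "x = y" if "\<And>P. P \<in> basic_open V h \<Longrightarrow> natural_map V h x P = natural_map V h y P"
      unfolding x(3) y(3)
    proof (rule loc_frac_coord_eqI[OF h x(1,2) y(1,2)])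
      fix P assume P: "P \<in> basic_open V h"
      then show "coord_eval P a / coord_eval P s = coord_eval P b / coord_eval P t"
        using that[OF P] unfolding x(3) y(3) nat[OF x(1,2)] nat[OF y(1,2)] by simp
    qed
  next
    fix c x assume "x \<in> carrier ?L"
    then obtain a s where x: "a \<in> carrier ?A" "s \<in> ?\<Sigma>" "x = loc_frac ?A ?\<Sigma> a s" by (rule cases)
    show "c \<odot>\<^bsub>?L\<^esub> x \<in> carrier ?L"
      unfolding x(3) ops(3)[OF x(1,2)] by (intro cl coord_algebra_closed x)
  next
    fix P assume P: "P \<in> basic_open V h"
    show "natural_map V h \<zero>\<^bsub>?L\<^esub> P = 0" "natural_map V h \<one>\<^bsub>?L\<^esub> P = 1"
      unfolding one zero using P DV[OF P]
      by (simp_all add: nat one\<Sigma> coord_algebra_closed coord_algebra_eval)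
  next
    fix P x y assume P: "P \<in> basic_open V h" and xy: "x \<in> carrier ?L" "y \<in> carrier ?L"
    obtain a s where x: "a \<in> carrier ?A" "s \<in> ?\<Sigma>" "x = loc_frac ?A ?\<Sigma> a s" using cases[OF xy(1)] .
    obtain b t where y: "b \<in> carrier ?A" "t \<in> ?\<Sigma>" "y = loc_frac ?A ?\<Sigma> b t" using cases[OF xy(2)] .
    note carr = \<Sigma>(1)[OF x(2)] \<Sigma>(1)[OF y(2)]
    show "natural_map V h (x \<oplus>\<^bsub>?L\<^esub> y) P = natural_map V h x P + natural_map V h y P"
      "natural_map V h (x \<otimes>\<^bsub>?L\<^esub> y) P = natural_map V h x P * natural_map V h y P"
      unfolding x(3) y(3) ops(1,2)[OF x(1,2) y(1,2)]
      using P DV[OF P] \<Sigma>(2)[OF x(2) P] \<Sigma>(2)[OF y(2) P] carr x(1,2) y(1,2)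
      by (simp_all add: nat mult\<Sigma> coord_algebra_closed coord_algebra_eval add_frac_eq)
  next
    fix P c x assume P: "P \<in> basic_open V h" and "x \<in> carrier ?L"
    from this(2) obtain a s where x: "a \<in> carrier ?A" "s \<in> ?\<Sigma>" "x = loc_frac ?A ?\<Sigma> a s" by (rule cases)
    show "natural_map V h (c \<odot>\<^bsub>?L\<^esub> x) P = c * natural_map V h x P"
      unfolding x(3) ops(3)[OF x(1,2)] using P DV[OF P] x(1,2)
      by (simp add: nat coord_algebra_closed coord_algebra_eval)
  qed
qed

text \<open>If every nonconstant polynomial over the field has a root, \<open>D = 1\<close> and \<open>m\<close> comes from the
  Nullstellensatz; otherwise \<open>m = 0\<close> and \<open>D\<close> is an anisotropic form in \<open>1 - X\<^sub>n H\<close> and an element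
  of \<open>J\<close> with the same zeros as \<open>J\<close>.\<close>

lemma signature_multiple_in_ideal:
  fixes J :: "(nat, 'k::field) mpoly set"
  assumes J: "ideal J (poly_algebra n)" and H: "H \<in> carrier (poly_algebra n)"
    and sub: "zero_set n J \<subseteq> zero_set n {H}"
  obtains m D L where "D \<in> alg_signature" "D \<in> carrier (poly_algebra (Suc n))" "L \<in> J"
    "\<And>P. mpoly_eval P H \<noteq> 0 \<Longrightarrow>
      mpoly_eval P H ^ m * mpoly_eval (P(n := 1 / mpoly_eval P H)) D = mpoly_eval P L"
proof (cases "\<forall>q :: 'k poly. Polynomial.degree q > 0 \<longrightarrow> (\<exists>t. poly q t = 0)")
  case True
  then obtain m where m: "H ^ m \<in> J" using nullstellensatz[OF _ J H sub] by blast
  show ?thesis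
    by (rule that[of 1 "H ^ m" m]) (simp_all add: m alg_signature_def poly_algebra_1 mpoly_eval_power)
next
  case False
  then obtain q :: "'k poly" where q: "Polynomial.degree q > 0" "\<And>t. poly q t \<noteq> 0" by blast
  obtain D L where DL: "D \<in> alg_signature \<inter> carrier (poly_algebra (Suc n))" "L \<in> J"
    "\<forall>P. mpoly_eval P H \<noteq> 0 \<longrightarrow> mpoly_eval (P(n := 1 / mpoly_eval P H)) D = mpoly_eval P L"
    using signature_element_rootless[OF J H sub q] by blast
  show ?thesis by (rule that[of D L 0]) (use DL in auto)
qed

lemma signature_element_in_Sigma_set:
  fixes V :: "(nat \<Rightarrow> 'k::field) set"
  assumes H: "H \<in> carrier (poly_algebra n)"
    and D: "D \<in> alg_signature" "D \<in> carrier (poly_algebra (Suc n))"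
  obtains \<alpha> where "\<alpha> \<in> Sigma_set (coord_algebra n V) (coord_class n V H)"
    "\<And>P. \<lbrakk>P \<in> V; mpoly_eval P H \<noteq> 0\<rbrakk> \<Longrightarrow> coord_eval P \<alpha> =
      mpoly_eval P H ^ (m + total_deg D) * mpoly_eval (P(n := 1 / mpoly_eval P H)) D"
proof -
  let ?A = "coord_algebra n V" and ?h = "coord_class n V H"
  have h: "?h \<in> carrier ?A" by (rule coord_algebra_class_closed[OF H])
  define b where "b v = coord_class n V (if v < n then H * Var v else if v = n then 1 else 0)" for v
  have b_poly: "(if v < n then H * Var v else if v = n then 1 else 0) \<in> carrier (poly_algebra n)" for v
    by (auto intro!: poly_algebra_closed H)
  have b: "b \<in> UNIV \<rightarrow> carrier ?A" unfolding b_def using coord_algebra_class_closed[OF b_poly] by blast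
  let ?b = "case_option (?h [^]\<^bsub>?A\<^esub> (1::nat)) b"
  have "?b v \<in> carrier ?A" for v
    using b coord_algebra_pow(1)[OF h] by (cases v) (simp_all only: option.case Pi_iff UNIV_I simp_thms)
  then have b': "?b \<in> UNIV \<rightarrow> carrier ?A" by blast
  let ?\<beta> = "alg_eval ?A ?b (homogenize D)"
  let ?\<alpha> = "?h [^]\<^bsub>?A\<^esub> m \<otimes>\<^bsub>?A\<^esub> ?\<beta>"
  show thesis
  proof (rule that)
    show "?\<alpha> \<in> Sigma_set ?A ?h" by (rule Sigma_set.gen[OF D(1) b])
    fix P assume P: "P \<in> V" and nz: "mpoly_eval P H \<noteq> 0"
    let ?R = "\<lambda>v. coord_eval P (?b v)"
    have R_None: "?R None = mpoly_eval P H"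
      using coord_algebra_pow(2)[OF h P, of 1] coord_eval_class[OF H P] by simp
    have R_Some: "?R (Some v) = mpoly_eval P (if v < n then H * Var v else if v = n then 1 else 0)" for v
      using coord_eval_class[OF b_poly P] by (simp add: b_def)
    have "mpoly_eval (\<lambda>v. ?R (Some v) / ?R None) D = mpoly_eval (P(n := 1 / mpoly_eval P H)) D"
    proof (rule mpoly_eval_cong[OF D(2)])
      fix v assume "v < Suc n"
      then show "?R (Some v) / ?R None = (P(n := 1 / mpoly_eval P H)) v"
        unfolding R_None R_Some using nz by (auto simp: mpoly_eval_mult less_Suc_eq)
    qed
    moreover have "coord_eval P ?\<beta> = mpoly_eval ?R (homogenize D)"
      by (rule coord_algebra_alg_eval(2)[OF b' P])
    ultimately have "coord_eval P ?\<beta> =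
        mpoly_eval P H ^ total_deg D * mpoly_eval (P(n := 1 / mpoly_eval P H)) D"
      using mpoly_eval_homogenize[of ?R D] R_None nz by simp
    then show "coord_eval P ?\<alpha> =
        mpoly_eval P H ^ (m + total_deg D) * mpoly_eval (P(n := 1 / mpoly_eval P H)) D"
      using coord_algebra_eval(4)[OF P coord_algebra_pow(1)[OF h] coord_algebra_alg_eval(1)[OF b'], of m "homogenize D"]
        coord_algebra_pow(2)[OF h P, of m] coord_eval_class[OF H P]
      by (simp add: power_add)
  qed
qed

text \<open>Numerators add and scale along with their denominators.\<close>

lemma ideal_denominators:
  fixes f :: "(nat \<Rightarrow> 'k::field) \<Rightarrow> 'k"
  shows "ideal {L \<in> carrier (poly_algebra n). \<exists>G\<in>carrier (poly_algebra n). \<forall>Q\<in>U.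
    mpoly_eval Q G = f Q * mpoly_eval Q L} (poly_algebra n)"
  unfolding ideal_poly_algebra_iff
proof (intro conjI ballI)
  let ?A = "carrier (poly_algebra n) :: (nat, 'k) mpoly set"
  let ?J = "{L \<in> ?A. \<exists>G\<in>?A. \<forall>Q\<in>U. mpoly_eval Q G = f Q * mpoly_eval Q L}"
  show "0 \<in> ?J" by (auto intro!: poly_algebra_0 bexI[of _ 0])
  fix p assume "p \<in> ?J"
  then obtain G where p: "p \<in> ?A" "G \<in> ?A" "\<And>Q. Q \<in> U \<Longrightarrow> mpoly_eval Q G = f Q * mpoly_eval Q p" by blast
  show "p + q \<in> ?J" if mem: "q \<in> ?J" for q
  proof -
    obtain G' where q: "q \<in> ?A" "G' \<in> ?A" "\<And>Q. Q \<in> U \<Longrightarrow> mpoly_eval Q G' = f Q * mpoly_eval Q q"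
      using mem by blast
    show ?thesis using p q
      by (auto intro!: bexI[of _ "G + G'"] simp: poly_algebra_add mpoly_eval_add distrib_left)
  qed
  show "q * p \<in> ?J" if "q \<in> ?A" for q
    using p that by (auto intro!: bexI[of _ "q * G"] simp: poly_algebra_mult mpoly_eval_mult)
qed auto

lemma regular_function_is_fraction:
  fixes V :: "(nat \<Rightarrow> 'k::field) set"
  assumes V: "affine_variety n V" and h: "h \<in> carrier (coord_algebra n V)"
    and f: "f \<in> regular_functions n V (basic_open V h)"
  obtains g \<alpha> where "g \<in> carrier (coord_algebra n V)" "\<alpha> \<in> Sigma_set (coord_algebra n V) h"
    "f = (\<lambda>P\<in>basic_open V h. coord_eval P g / coord_eval P \<alpha>)"
proof -
  let ?A = "carrier (poly_algebra n) :: (nat, 'k) mpoly set" and ?U = "basic_open V h"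
  obtain I where I: "ideal I (poly_algebra n)" "V = zero_set n I"
    using V by (auto simp: affine_variety_def)
  obtain H where H: "H \<in> ?A" "h = coord_class n V H" "\<And>P. P \<in> V \<Longrightarrow> coord_eval P h = mpoly_eval P H"
    using coord_algebra_cases[OF h] by metis
  have U: "P \<in> ?U \<longleftrightarrow> P \<in> V \<and> mpoly_eval P H \<noteq> 0" for P
    using H(3) by (auto simp: basic_open_def)
  define J where "J = {L \<in> ?A. \<exists>G\<in>?A. \<forall>Q\<in>?U. mpoly_eval Q G = f Q * mpoly_eval Q L}"
  have J: "ideal J (poly_algebra n)" unfolding J_def by (rule ideal_denominators)
  have "zero_set n J \<subseteq> zero_set n {H}"
  proof
    fix x assume x: "x \<in> zero_set n J"
    then have xJ: "\<And>p. p \<in> J \<Longrightarrow> mpoly_eval x p = 0" and xA: "x \<in> affine_space n"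
      by (auto simp: zero_set_def)
    \<comment> \<open>Elements of \<open>I\<close> vanish on D(h) and have numerator 0. The
      inclusion confines the zeros of \<open>J\<close> to \<open>V\<close>.\<close>
    have "I \<subseteq> J"
    proof
      fix p assume p: "p \<in> I"
      then have "p \<in> ?A" using I(1) by (auto simp: ideal_poly_algebra_iff)
      moreover have "mpoly_eval Q p = 0" if "Q \<in> ?U" for Q
        using that[unfolded U] p I(2) by (auto simp: zero_set_def)
      ultimately show "p \<in> J" by (auto simp: J_def intro!: bexI[of _ 0] poly_algebra_0)
    qed
    then have xV: "x \<in> V" using xJ xA I(2) by (auto simp: zero_set_def)
    have "mpoly_eval x H = 0"
    proof (rule ccontr)
      assume "mpoly_eval x H \<noteq> 0"
      then have "x \<in> ?U" using xV U by blast
      then obtain W g l where W: "openin (variety_topology n V) W" "x \<in> W" "W \<subseteq> ?U"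
        and g: "g \<in> carrier (coord_algebra n V)" "l \<in> carrier (coord_algebra n V)"
        and eq: "\<And>Q. Q \<in> W \<Longrightarrow> coord_eval Q l \<noteq> 0"
          "\<And>Q. Q \<in> W \<Longrightarrow> f Q = coord_eval Q g / coord_eval Q l"
        using regular_functions_local[OF f] by metis
      obtain G where G: "G \<in> ?A" "\<And>P. P \<in> V \<Longrightarrow> coord_eval P g = mpoly_eval P G"
        using coord_algebra_cases[OF g(1)] by metis
      obtain L where L: "L \<in> ?A" "\<And>P. P \<in> V \<Longrightarrow> coord_eval P l = mpoly_eval P L"
        using coord_algebra_cases[OF g(2)] by metis
      obtain F where F: "F \<subseteq> ?A" "W = (affine_space n - zero_set n F) \<inter> V"
        using W(1) unfolding openin_variety_topology by blast
      then obtain p where p: "p \<in> F" "mpoly_eval x p \<noteq> 0" using W(2) by (auto simp: zero_set_def)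
      \<comment> \<open>\<open>p\<close> turns the local fraction into an identity on all of D(h):
        outside \<open>W\<close> it vanishes, and with it both sides.\<close>
      have "mpoly_eval Q (p * G) = f Q * mpoly_eval Q (p * L)" if Q: "Q \<in> ?U" for Q
      proof (cases "Q \<in> W")
        case True
        then show ?thesis using eq[OF True] Q U G(2) L(2) by (simp add: mpoly_eval_mult)
      next
        case False
        moreover have "Q \<in> V" using Q U by blast
        moreover have "Q \<in> affine_space n" using \<open>Q \<in> V\<close> I(2) by (simp add: zero_set_def)
        ultimately have "mpoly_eval Q p = 0" using p(1) by (auto simp: F(2) zero_set_def)
        then show ?thesis by (simp add: mpoly_eval_mult)
      qed
      moreover have "p \<in> ?A" using p(1) F(1) by blast
      ultimately have "p * L \<in> J" unfolding J_def using G(1) L(1)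
        by (auto intro!: bexI[of _ "p * G"] poly_algebra_mult)
      then have "mpoly_eval x L = 0" using xJ[of "p * L"] p(2) by (simp add: mpoly_eval_mult)
      then show False using eq(1)[OF W(2)] L(2)[OF xV] by simp
    qed
    then show "x \<in> zero_set n {H}" using xA by (simp add: zero_set_def)
  qed
  then obtain m D L where D: "D \<in> alg_signature" "D \<in> carrier (poly_algebra (Suc n))" and "L \<in> J"
    and DL: "\<And>P. mpoly_eval P H \<noteq> 0 \<Longrightarrow>
      mpoly_eval P H ^ m * mpoly_eval (P(n := 1 / mpoly_eval P H)) D = mpoly_eval P L"
    using signature_multiple_in_ideal[OF J H(1)] by metis
  then obtain G where G: "G \<in> ?A" "\<And>Q. Q \<in> ?U \<Longrightarrow> mpoly_eval Q G = f Q * mpoly_eval Q L"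
    unfolding J_def by blast
  obtain \<alpha> where \<alpha>: "\<alpha> \<in> Sigma_set (coord_algebra n V) h"
    "\<And>P. \<lbrakk>P \<in> V; mpoly_eval P H \<noteq> 0\<rbrakk> \<Longrightarrow> coord_eval P \<alpha> =
      mpoly_eval P H ^ (m + total_deg D) * mpoly_eval (P(n := 1 / mpoly_eval P H)) D"
    using signature_element_in_Sigma_set[OF H(1) D, where V = V and m = m] unfolding H(2) by metis
  \<comment> \<open>Homogenization gives \<open>\<alpha>\<close> the value
    H^\<open>total_deg D\<close> times \<open>L\<close>; the numerator receives the same power of
    \<open>H\<close>.\<close>
  let ?G = "H ^ total_deg D * G"
  let ?g = "coord_class n V ?G"
  have GA: "?G \<in> ?A" by (intro poly_algebra_closed H G)
  show thesis
  proof (rule that[OF coord_algebra_class_closed[OF GA] \<alpha>(1)])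
    show "f = (\<lambda>P\<in>?U. coord_eval P ?g / coord_eval P \<alpha>)"
    proof (rule PiE_ext[of _ ?U "\<lambda>_. UNIV"])
      show "f \<in> ?U \<rightarrow>\<^sub>E UNIV" using f by (simp add: regular_functions_def)
      fix P assume P: "P \<in> ?U"
      then have PV: "P \<in> V" and nz: "mpoly_eval P H \<noteq> 0" using U by auto
      have "coord_eval P \<alpha> = mpoly_eval P H ^ total_deg D * mpoly_eval P L"
        using \<alpha>(2)[OF PV nz] DL[OF nz] by (simp add: power_add mult_ac)
      \<comment> \<open>This yields that \<open>L\<close> is nonzero at \<open>P\<close>, so it can
        be cancelled.\<close>
      moreover have "coord_eval P \<alpha> \<noteq> 0" by (rule Sigma_set_coord(2)[OF h \<alpha>(1) P])
      moreover have "coord_eval P ?g = mpoly_eval P H ^ total_deg D * (f P * mpoly_eval P L)"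
        by (simp add: coord_eval_class[OF GA PV] mpoly_eval_simps G(2)[OF P])
      ultimately show "f P = (\<lambda>P\<in>?U. coord_eval P ?g / coord_eval P \<alpha>) P"
        using P nz by simp
    qed simp
  qed
qed

text \<open>Both algebras are function algebras over the points of D(h), and the map preserves
  values; separation of points makes it an injective morphism. Surjectivity is
  \<open>regular_function_is_fraction\<close>.\<close>

lemma kalg_iso_natural_map:
  fixes V :: "(nat \<Rightarrow> 'k::field) set"
  assumes V: "affine_variety n V" and h: "h \<in> carrier (coord_algebra n V)"
  shows "kalg_iso (Sigma_localization (coord_algebra n V) h) (regular_algebra n V (basic_open V h))
    (natural_map V h)"
proof -
  let ?L = "Sigma_localization (coord_algebra n V) h" and ?R = "regular_algebra n V (basic_open V h)"
  have "V \<subseteq> affine_space n" using V by (auto simp: affine_variety_def zero_set_def)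
  then have U: "openin (variety_topology n V) (basic_open V h)" by (rule openin_basic_open[OF _ h])
  interpret L: function_algebra ?L "basic_open V h" "\<lambda>P x. natural_map V h x P"
    by (rule function_algebra_Sigma_localization[OF h])
  interpret R: function_algebra ?R "basic_open V h" "\<lambda>P f. f P"
    by (rule function_algebra_regular[OF U])
  have closed: "natural_map V h x \<in> carrier ?R" if mem: "x \<in> carrier ?L" for x
  proof -
    obtain a s where x: "a \<in> carrier (coord_algebra n V)" "s \<in> Sigma_set (coord_algebra n V) h"
      "x = loc_frac (coord_algebra n V) (Sigma_set (coord_algebra n V) h) a s"
      using Sigma_localization_cases[OF h mem] .
    show ?thesis
      unfolding x(3) natural_map_loc_frac[OF h x(1,2)]
      using regular_functions_fraction[OF U x(1) Sigma_set_coord[OF h x(2)]]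
      by (simp add: regular_algebra_def)
  qed
  have "kalg_hom ?L ?R (natural_map V h)"
    unfolding kalg_hom_def
    by (intro conjI L.fa_kalgebra R.fa_kalgebra ring_hom_memI allI ballI R.fa_eqI)
      (simp_all add: closed L.fa_closed R.fa_closed L.fa_eval R.fa_eval)
  moreover have "inj_on (natural_map V h) (carrier ?L)"
    by (intro inj_onI L.fa_eqI) simp_all
  moreover have "carrier ?R \<subseteq> natural_map V h ` carrier ?L"
  proof
    fix f assume "f \<in> carrier ?R"
    then have "f \<in> regular_functions n V (basic_open V h)" by (simp add: regular_algebra_def)
    then obtain g \<alpha> where g: "g \<in> carrier (coord_algebra n V)" "\<alpha> \<in> Sigma_set (coord_algebra n V) h"
      "f = (\<lambda>P\<in>basic_open V h. coord_eval P g / coord_eval P \<alpha>)"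
      by (rule regular_function_is_fraction[OF V h])
    show "f \<in> natural_map V h ` carrier ?L"
      using Sigma_localization_frac_closed[OF g(1,2)] natural_map_loc_frac[OF h g(1,2)]
      unfolding g(3) by (intro image_eqI) auto
  qed
  ultimately show ?thesis using closed by (auto simp: kalg_iso_def bij_betw_def)
qed

theorem theorem3p4:
  fixes n :: nat and V :: "(nat \<Rightarrow> 'k::field) set" and h :: "(nat, 'k) mpoly set"
  assumes "affine_variety n V" and "h \<in> carrier (coord_algebra n V)"
  shows
    "(\<forall>g\<in>carrier (coord_algebra n V). \<forall>\<alpha>\<in>Sigma_set (coord_algebra n V) h.
        natural_map V h (loc_frac (coord_algebra n V) (Sigma_set (coord_algebra n V) h) g \<alpha>)
          = (\<lambda>P\<in>basic_open V h. coord_eval P g / coord_eval P \<alpha>)) \<and>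
     kalg_iso (Sigma_localization (coord_algebra n V) h) (regular_algebra n V (basic_open V h))
       (natural_map V h) \<and>
     kalg_sheaf (variety_topology n V) (regular_algebra n V) (\<lambda>U W f. restrict f W) \<and>
     (\<forall>U. openin (variety_topology n V) U \<longrightarrow>
        essential (regular_algebra n V U) \<and> star_algebra (regular_algebra n V U))"
  using natural_map_loc_frac[OF assms(2)] kalg_iso_natural_map[OF assms]
    kalg_sheaf_regular_algebra[of n V] essential_regular_algebra star_algebra_regular_algebra
  by blast

end
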